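(* Let $m=\mathrm{poly}(n)$ with $m>cn$ for some constant $c>1$, and let $p=\omega(1/n)$. Let $\mathbf A\in\mathbb{Z}_2^{2n\times n}$ be a uniformly random full-rank isotropic matrix and let $\mathbf B\in\mathbb{Z}_2^{m\times2n}$ be a random variable independent of $\mathbf A$ such that $\mathbf B\mathbf A\in\mathbb{Z}_2^{m\times n}$ is within negligible total variation distance of a uniformly random matrix. Fix any $\delta>0$ and let $r:=n/m$. Then $\Pr_{\mathbf B}\Big[\mathbb{E}_{\mathbf e\sim\mathcal{D}_p^{\otimes n}}[|\mathbf B\mathbf e|]\ge\tfrac{1-r-\delta}{2}\,m\Big]\ge1-\mathrm{negl}(n),$ where $|\cdot|$ denotes Hamming weight and $\mathbf e$ is independent of $\mathbf B$.
   Context: Symplectic inner product on $\mathbb{Z}_2^{2n}$: $(\mathbf a,\mathbf b)\odot(\mathbf a',\mathbf b')=\mathbf a\cdot\mathbf b'+\mathbf a'\cdot\mathbf b\pmod2$. A uniformly random full-rank isotropic matrix in $\mathbb{Z}_2^{2n\times n}$ is uniform among matrices of column rank $n$ with pairwise symplectically orthogonal columns. $\mathcal{D}_p^{\otimes n}$: random $\mathbf e\in\mathbb{Z}_2^{2n}$ with independent pairs $(e_j,e_{n+j})$, each $(0,0)$ w.p. $1-p$ and each of $(0,1),(1,0),(1,1)$ w.p. $p/3$. *)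

theory Defs
  imports "HOL-Probability.Probability"
begin

text \<open>Binary matrices / vectors over Z_2 are encoded as boolean-valued functions
  on natural-number indices that vanish outside the stated bounds.\<close>

type_synonym bmat = "nat \<Rightarrow> nat \<Rightarrow> bool"
type_synonym bvec = "nat \<Rightarrow> bool"

definition mats :: "nat \<Rightarrow> nat \<Rightarrow> bmat set" where
  "mats r k = {M. \<forall>i j. (r \<le> i \<or> k \<le> j) \<longrightarrow> \<not> M i j}"

definition mmul :: "nat \<Rightarrow> bmat \<Rightarrow> bmat \<Rightarrow> bmat" where
  "mmul k M N = (\<lambda>i j. odd (card {l. l < k \<and> M i l \<and> N l j}))"

definition mvec :: "nat \<Rightarrow> bmat \<Rightarrow> bvec \<Rightarrow> bvec" where
  "mvec k M v = (\<lambda>i. odd (card {l. l < k \<and> M i l \<and> v l}))"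

definition hweight :: "nat \<Rightarrow> bvec \<Rightarrow> nat" where
  "hweight r v = card {i. i < r \<and> v i}"

definition symp_cols :: "nat \<Rightarrow> bmat \<Rightarrow> nat \<Rightarrow> nat \<Rightarrow> bool" where
  "symp_cols n A j j' =
     odd (card {i. i < n \<and> A i j \<and> A (n + i) j'} + card {i. i < n \<and> A i j' \<and> A (n + i) j})"

text \<open>Full column rank over Z_2: the columns are linearly independent, i.e. no
  nonempty set of columns sums to zero.\<close>
definition full_col_rank :: "nat \<Rightarrow> nat \<Rightarrow> bmat \<Rightarrow> bool" where
  "full_col_rank r k A =
     (\<forall>S. S \<subseteq> {..<k} \<and> S \<noteq> {} \<longrightarrow> (\<exists>i<r. odd (card {j\<in>S. A i j})))"

definition iso_fr :: "nat \<Rightarrow> bmat set" where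
  "iso_fr n = {A \<in> mats (2*n) n. full_col_rank (2*n) n A \<and>
                 (\<forall>j<n. \<forall>j'<n. \<not> symp_cols n A j j')}"

definition BA_dist :: "nat \<Rightarrow> bmat pmf \<Rightarrow> bmat pmf" where
  "BA_dist n Bd = do { Bm \<leftarrow> Bd; A \<leftarrow> pmf_of_set (iso_fr n); return_pmf (mmul (2*n) Bm A) }"

definition tv_dist :: "'a pmf \<Rightarrow> 'a pmf \<Rightarrow> real" where
  "tv_dist P Q = (SUP S. \<bar>measure_pmf.prob P S - measure_pmf.prob Q S\<bar>)"

definition negligible :: "(nat \<Rightarrow> real) \<Rightarrow> bool" where
  "negligible f \<longleftrightarrow> (\<forall>c::nat. (\<lambda>n. real n ^ c * \<bar>f n\<bar>) \<longlonglongrightarrow> 0)"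

definition pauli_pmf :: "real \<Rightarrow> (bool \<times> bool) pmf" where
  "pauli_pmf p = do { b \<leftarrow> bernoulli_pmf p;
      if b then pmf_of_set {(False, True), (True, False), (True, True)}
      else return_pmf (False, False) }"

definition Dp :: "nat \<Rightarrow> real \<Rightarrow> bvec pmf" where
  "Dp n p = map_pmf
     (\<lambda>f i. if i < n then fst (f i) else if i < 2*n then snd (f (i - n)) else False)
     (Pi_pmf {..<n} (False, False) (\<lambda>_. pauli_pmf p))"

end

theory Submission
  imports Defs "HOL-Library.Function_Algebras" "HOL-Library.Z2" "HOL-Real_Asymp.Real_Asymp"
begin

text \<open>
  A row of \<open>B\<close> of symplectic weight \<open>w\<close> contributes \<open>(1 - (1 - 4p/3)^w) / 2\<close> to the expected
  Hamming weight, which is \<open>1/2 - o(1)\<close> as soon as \<open>w\<close> is at least a constant fraction of \<open>n\<close>. So it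
  suffices that with overwhelming probability at most \<open>n + 2a\<close> rows are light, where \<open>a\<close> is a small
  multiple of \<open>n\<close>. If \<open>n + 2a\<close> rows \<open>b\<close> of \<open>B\<close> are light, consider the corresponding rows \<open>Y\<close> of
  \<open>BA\<close>. A relation \<open>c Y = 0\<close> means that \<open>c b\<close> is orthogonal to the columns of \<open>A\<close>, that is, lies in a
  Lagrangian subspace; hence the left kernel of \<open>Y\<close>, of dimension at least \<open>2a\<close>, is isotropic for the
  form pulled back along \<open>c \<mapsto> c b\<close>. For fixed \<open>b\<close> this has probability \<open>2^(-a^2 + O(a))\<close> for uniform
  \<open>Y\<close>, and there are so few light vectors that a union bound over \<open>b\<close> and over the positions of the
  rows still gives \<open>2^(-\<Omega>(n^2))\<close>. Closeness of \<open>BA\<close> to uniform transfers this to \<open>B\<close>.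
\<close>

section \<open>Pairings over the field with two elements\<close>

text \<open>The default simplification rules rewrite bit arithmetic to bit operations, away from the ring operations.\<close>

declare add_bit_eq_xor [simp del] mult_bit_eq_and [simp del] minus_bit_def [simp del]
  uminus_bit_def [simp del]

text \<open>For a finite set containing 0, closure under addition already gives closure under
  negation.\<close>

definition finite_subgroup :: "'a::ab_group_add set \<Rightarrow> bool" where
  "finite_subgroup W \<longleftrightarrow> finite W \<and> 0 \<in> W \<and> (\<forall>x\<in>W. \<forall>y\<in>W. x + y \<in> W)"

definition biadditive :: "('a::ab_group_add \<Rightarrow> 'b::ab_group_add \<Rightarrow> bit) \<Rightarrow> bool" where
  "biadditive \<beta> \<longleftrightarrow> (\<forall>x y z. \<beta> (x + y) z = \<beta> x z + \<beta> y z) \<and> (\<forall>x y z. \<beta> x (y + z) = \<beta> x y + \<beta> x z)"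

text \<open>The nontrivial additive character of the field with two elements.\<close>

definition sgn_bit :: "bit \<Rightarrow> int" where
  "sgn_bit b = (if b = 0 then 1 else -1)"

lemma bit_add_self: "(b::bit) + b = 0"
  by (cases b) (auto simp: add_bit_eq_xor)

lemma sgn_bit_add: "sgn_bit (a + b) = sgn_bit a * sgn_bit b"
  by (cases a; cases b) (auto simp: sgn_bit_def add_bit_eq_xor)

lemma biadditive_zero:
  assumes "biadditive \<beta>"
  shows "\<beta> 0 x = 0" "\<beta> y 0 = 0"
proof -
  have "\<beta> (0+0) x = \<beta> 0 x + \<beta> 0 x" "\<beta> y (0+0) = \<beta> y 0 + \<beta> y 0"
    using assms unfolding biadditive_def by blast+
  then show "\<beta> 0 x = 0" "\<beta> y 0 = 0" by (simp_all add: bit_add_self)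
qed

lemma biadditive_swap: "biadditive \<beta> \<Longrightarrow> biadditive (\<lambda>x y. \<beta> y x)"
  unfolding biadditive_def by blast

lemma translate_image:
  assumes "finite_subgroup X" "x0 \<in> X"
  shows "(\<lambda>x. x + x0) ` X = X" "inj_on (\<lambda>x. x + x0) X"
proof -
  show i: "inj_on (\<lambda>x. x + x0) X" by (auto simp: inj_on_def)
  have "(\<lambda>x. x + x0) ` X \<subseteq> X" using assms by (auto simp: finite_subgroup_def)
  then show "(\<lambda>x. x + x0) ` X = X"
    using assms i by (meson finite_subgroup_def endo_inj_surj)
qed

text \<open>Orthogonality of characters: translation by some \<open>x0\<close> with
  \<open>\<beta> w x0 = 1\<close> permutes \<open>X\<close> and flips every sign, so the sum equals
  its own negative.\<close>

lemma sum_sgn_bit: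
  assumes X: "finite_subgroup X" and \<beta>: "biadditive \<beta>"
  shows "(\<Sum>x\<in>X. sgn_bit (\<beta> w x)) = (if \<forall>x\<in>X. \<beta> w x = 0 then int (card X) else 0)"
proof (cases "\<forall>x\<in>X. \<beta> w x = 0")
  case True
  then show ?thesis by (simp add: sgn_bit_def)
next
  case False
  then obtain x0 where x0: "x0 \<in> X" "\<beta> w x0 = 1" by auto
  have "(\<Sum>x\<in>X. sgn_bit (\<beta> w x)) = (\<Sum>x\<in>(\<lambda>x. x + x0) ` X. sgn_bit (\<beta> w x))"
    using translate_image[OF X x0(1)] by simp
  also have "\<dots> = (\<Sum>x\<in>X. sgn_bit (\<beta> w (x + x0)))"
    by (subst sum.reindex[OF translate_image(2)[OF X x0(1)]]) simp
  also have "\<dots> = (\<Sum>x\<in>X. - sgn_bit (\<beta> w x))"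
    using \<beta> x0(2) by (intro sum.cong) (auto simp: biadditive_def sgn_bit_add, simp add: sgn_bit_def)
  also have "\<dots> = - (\<Sum>x\<in>X. sgn_bit (\<beta> w x))" by (simp add: sum_negf)
  finally show ?thesis using False by auto
qed

text \<open>The sum of all signs over \<open>W\<close> and \<open>X\<close> is evaluated in both
  orders with \<open>sum_sgn_bit\<close>. The identity takes the place of dimension counting for
  orthogonal complements throughout.\<close>

lemma pairing_card:
  assumes X: "finite_subgroup X" and W: "finite_subgroup W" and \<beta>: "biadditive \<beta>"
  shows "card W * card {x\<in>X. \<forall>w\<in>W. \<beta> w x = 0} = card X * card {w\<in>W. \<forall>x\<in>X. \<beta> w x = 0}"
proof -
  have fin: "finite X" "finite W" using X W by (auto simp: finite_subgroup_def)
  have "(\<Sum>w\<in>W. \<Sum>x\<in>X. sgn_bit (\<beta> w x)) = (\<Sum>w\<in>W. if \<forall>x\<in>X. \<beta> w x = 0 then int (card X) else 0)"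
    by (intro sum.cong refl sum_sgn_bit X \<beta>)
  also have "\<dots> = int (card X * card {w\<in>W. \<forall>x\<in>X. \<beta> w x = 0})"
    using fin by (simp add: sum.inter_filter[symmetric] mult.commute)
  finally have 1: "(\<Sum>w\<in>W. \<Sum>x\<in>X. sgn_bit (\<beta> w x)) = int (card X * card {w\<in>W. \<forall>x\<in>X. \<beta> w x = 0})" .
  have "(\<Sum>x\<in>X. \<Sum>w\<in>W. sgn_bit (\<beta> w x)) = (\<Sum>x\<in>X. if \<forall>w\<in>W. \<beta> w x = 0 then int (card W) else 0)"
    by (intro sum.cong refl sum_sgn_bit[OF W biadditive_swap[OF \<beta>]])
  also have "\<dots> = int (card W * card {x\<in>X. \<forall>w\<in>W. \<beta> w x = 0})"
    using fin by (simp add: sum.inter_filter[symmetric] mult.commute)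
  finally have 2: "(\<Sum>x\<in>X. \<Sum>w\<in>W. sgn_bit (\<beta> w x)) = int (card W * card {x\<in>X. \<forall>w\<in>W. \<beta> w x = 0})" .
  have "(\<Sum>w\<in>W. \<Sum>x\<in>X. sgn_bit (\<beta> w x)) = (\<Sum>x\<in>X. \<Sum>w\<in>W. sgn_bit (\<beta> w x))" by (rule sum.swap)
  with 1 2 show ?thesis by linarith
qed

section \<open>Annihilators of lists\<close>

definition annih :: "('a \<Rightarrow> 'b \<Rightarrow> bit) \<Rightarrow> 'b set \<Rightarrow> 'a list \<Rightarrow> 'b set" where
  "annih \<beta> X cs = {x\<in>X. \<forall>c\<in>set cs. \<beta> c x = 0}"

lemma annih_Nil [simp]: "annih \<beta> X [] = X"
  by (simp add: annih_def)

lemma annih_Cons: "annih \<beta> X (c # cs) = {x\<in>annih \<beta> X cs. \<beta> c x = 0}"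
  by (auto simp: annih_def)

lemma annih_closed:
  assumes "finite_subgroup X" "biadditive \<beta>"
  shows "finite_subgroup (annih \<beta> X cs)"
  using assms biadditive_zero[OF assms(2)]
  by (auto simp: annih_def finite_subgroup_def biadditive_def)

text \<open>The sign sum vanishes, so the values 0 and 1 are taken equally often.\<close>

lemma card_hyperplane:
  assumes X: "finite_subgroup X" and \<beta>: "biadditive \<beta>" and ne: "\<not> (\<forall>x\<in>X. \<beta> c x = 0)"
  shows "2 * card {x\<in>X. \<beta> c x = 0} = card X"
proof -
  have fin: "finite X" using X by (auto simp: finite_subgroup_def)
  have "0 = (\<Sum>x\<in>X. sgn_bit (\<beta> c x))" using sum_sgn_bit[OF X \<beta>, of c] ne by auto
  also have "\<dots> = int (card {x\<in>X. \<beta> c x = 0}) - int (card {x\<in>X. \<beta> c x \<noteq> 0})"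
    unfolding sgn_bit_def using fin by (subst sum.If_cases) (auto simp: Int_def)
  finally have e: "card {x\<in>X. \<beta> c x = 0} = card {x\<in>X. \<beta> c x \<noteq> 0}" by linarith
  have "card X = card ({x\<in>X. \<beta> c x = 0} \<union> {x\<in>X. \<beta> c x \<noteq> 0})"
    by (rule arg_cong[where f=card]) auto
  also have "\<dots> = card {x\<in>X. \<beta> c x = 0} + card {x\<in>X. \<beta> c x \<noteq> 0}"
    using fin by (intro card_Un_disjoint) auto
  finally show ?thesis using e by simp
qed

lemma card_annih_ge:
  assumes X: "finite_subgroup X" and \<beta>: "biadditive \<beta>"
  shows "card X \<le> 2 ^ length cs * card (annih \<beta> X cs)"
proof (induction cs)
  case (Cons c cs)
  have "card (annih \<beta> X cs) \<le> 2 * card (annih \<beta> X (c # cs))"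
  proof (cases "\<forall>x\<in>annih \<beta> X cs. \<beta> c x = 0")
    case True
    then have "annih \<beta> X (c # cs) = annih \<beta> X cs" by (auto simp: annih_Cons)
    then show ?thesis by simp
  next
    case False
    then show ?thesis using card_hyperplane[OF annih_closed[OF X \<beta>] \<beta> False] by (simp add: annih_Cons)
  qed
  then have "2 ^ length cs * card (annih \<beta> X cs) \<le> 2 ^ length cs * (2 * card (annih \<beta> X (c # cs)))"
    by (rule mult_le_mono2)
  with Cons have "card X \<le> 2 ^ length cs * (2 * card (annih \<beta> X (c # cs)))" by (rule order_trans)
  then show ?case by (simp add: mult.assoc mult.left_commute)
qed simp

section \<open>Counting tuples by the size of their annihilators\<close>

definition tuples :: "'a set \<Rightarrow> nat \<Rightarrow> 'a list set" where
  "tuples X t = {xs. set xs \<subseteq> X \<and> length xs = t}"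

lemma finite_tuples [simp]: "finite X \<Longrightarrow> finite (tuples X t)"
  unfolding tuples_def by (rule finite_lists_length_eq)

lemma card_tuples: "finite X \<Longrightarrow> card (tuples X t) = card X ^ t"
  unfolding tuples_def by (rule card_lists_length_eq)

lemma tuples_0 [simp]: "tuples X 0 = {[]}"
  by (auto simp: tuples_def)

lemma sum_tuples_Suc:
  fixes f :: "'a list \<Rightarrow> nat"
  assumes "finite X"
  shows "(\<Sum>xs\<in>tuples X (Suc j). f xs) = (\<Sum>xs\<in>tuples X j. \<Sum>x\<in>X. f (x # xs))"
proof -
  have im: "tuples X (Suc j) = (\<lambda>(xs, x). x # xs) ` (tuples X j \<times> X)"
    by (auto simp: tuples_def length_Suc_conv image_iff)
  have "(\<Sum>xs\<in>tuples X (Suc j). f xs) = (\<Sum>(xs, x)\<in>tuples X j \<times> X. f (x # xs))"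
    unfolding im by (subst sum.reindex) (auto simp: inj_on_def intro!: sum.cong)
  also have "\<dots> = (\<Sum>xs\<in>tuples X j. \<Sum>x\<in>X. f (x # xs))"
    by (simp add: sum.cartesian_product)
  finally show ?thesis .
qed

text \<open>The elements counted on the left are those whose insertion into \<open>cs\<close> leaves
  the annihilator unchanged. The bound is \<open>pairing_card\<close> for \<open>C\<close> and the
  annihilator, followed by enlarging the annihilator to \<open>X\<close> in the radical.\<close>

lemma card_stabilizers:
  assumes X: "finite_subgroup X" and \<beta>: "biadditive \<beta>"
    and C: "finite_subgroup C"
  shows "card {c\<in>C. \<forall>x\<in>annih \<beta> X cs. \<beta> c x = 0} * card (annih \<beta> X cs) \<le> card C * card {x\<in>X. \<forall>c\<in>C. \<beta> c x = 0}"
proof -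
  have fX: "finite X" using X by (simp add: finite_subgroup_def)
  have e: "card C * card {x\<in>annih \<beta> X cs. \<forall>c\<in>C. \<beta> c x = 0} = card (annih \<beta> X cs) * card {c\<in>C. \<forall>x\<in>annih \<beta> X cs. \<beta> c x = 0}"
    by (rule pairing_card[OF annih_closed[OF X \<beta>] C \<beta>])
  have "card {x\<in>annih \<beta> X cs. \<forall>c\<in>C. \<beta> c x = 0} \<le> card {x\<in>X. \<forall>c\<in>C. \<beta> c x = 0}"
    using fX by (intro card_mono) (auto simp: annih_def)
  then have "card C * card {x\<in>annih \<beta> X cs. \<forall>c\<in>C. \<beta> c x = 0} \<le> card C * card {x\<in>X. \<forall>c\<in>C. \<beta> c x = 0}"
    by (rule mult_le_mono2)
  then show ?thesis unfolding e by (simp only: mult.commute)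
qed

text \<open>Each new entry halves the annihilator, except for a fraction at most \<open>2^(-a)\<close> of the choices.
  The sum over \<open>a\<close>-tuples counts the pairs of \<open>a\<close>-tuples that are orthogonal to each other.\<close>

lemma sum_card_annih_pow:
  assumes X: "finite_subgroup X" and \<omega>: "biadditive \<omega>"
    and rad: "card {x\<in>X. \<forall>c\<in>X. \<omega> c x = 0} * 4 ^ a \<le> card X" and "j \<le> a"
  shows "(\<Sum>cs\<in>tuples X j. card (annih \<omega> X cs) ^ a) * 2 ^ (a * j) \<le> 2 ^ j * card X ^ (j + a)"
  using \<open>j \<le> a\<close>
proof (induction j)
  case (Suc j)
  have fX: "finite X" using X by (auto simp: finite_subgroup_def)
  have step: "(\<Sum>c\<in>X. card (annih \<omega> X (c # cs)) ^ a) * 2 ^ a \<le> 2 * card X * card (annih \<omega> X cs) ^ a"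
    if cs: "cs \<in> tuples X j" for cs
  proof -
    define P where "P = annih \<omega> X cs"
    \<comment> \<open>The entries that leave the annihilator \<open>P\<close> as it is; every other
      entry halves it.\<close>
    define U where "U = {c\<in>X. \<forall>x\<in>P. \<omega> c x = 0}"
    have Pc: "finite_subgroup P" unfolding P_def by (rule annih_closed[OF X \<omega>])
    have Ppos: "card P > 0" using Pc by (auto simp: finite_subgroup_def card_gt_0_iff)
    have len: "length cs = j" using cs by (simp add: tuples_def)
    have "card U * card P \<le> card X * card {x\<in>X. \<forall>c\<in>X. \<omega> c x = 0}"
      unfolding U_def P_def by (rule card_stabilizers[OF X \<omega> X])
    then have "card U * card P * 4 ^ a \<le> card X * (card {x\<in>X. \<forall>c\<in>X. \<omega> c x = 0} * 4 ^ a)"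
      by (simp add: mult.assoc[symmetric])
    also have "\<dots> \<le> card X * card X" using rad by simp
    also have "\<dots> \<le> card X * (2 ^ j * card P)"
      using card_annih_ge[OF X \<omega>, of cs] len by (simp add: P_def)
    finally have "(card U * 4 ^ a) * card P \<le> (card X * 2 ^ j) * card P" by (simp add: mult_ac)
    then have "card U * 4 ^ a \<le> card X * 2 ^ j" using Ppos by simp
    \<comment> \<open>Of the factor \<open>4 ^ a\<close> in \<open>rad\<close>, one
      \<open>2 ^ a\<close> covers the shrinking of the annihilator by the \<open>j\<close> entries
      chosen so far; the other one bounds the fraction of \<open>U\<close> in
      \<open>X\<close>.\<close>
    also have "\<dots> \<le> card X * 2 ^ a" using Suc.prems by (intro mult_le_mono2 power_increasing) auto
    finally have "(card U * 2 ^ a) * 2 ^ a \<le> card X * 2 ^ a"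
      by (simp add: mult.assoc flip: power_mult_distrib)
    then have U: "card U * 2 ^ a \<le> card X" by simp
    have in_U: "annih \<omega> X (c # cs) = P" if "c \<in> U" for c
      using that by (auto simp: annih_Cons U_def P_def)
    have not_in_U: "2 * card (annih \<omega> X (c # cs)) = card P" if "c \<in> X - U" for c
      unfolding annih_Cons P_def[symmetric] using that
      by (intro card_hyperplane[OF Pc \<omega>]) (auto simp: U_def)
    have "(\<Sum>c\<in>X. card (annih \<omega> X (c # cs)) ^ a) =
        (\<Sum>c\<in>X - U. card (annih \<omega> X (c # cs)) ^ a) + (\<Sum>c\<in>U. card (annih \<omega> X (c # cs)) ^ a)"
      using fX by (intro sum.subset_diff) (auto simp: U_def)
    \<comment> \<open>The factor \<open>2 ^ a\<close> undoes the halving outside \<open>U\<close>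
      and is compensated by the smallness of \<open>U\<close> inside; each part is then at most
      \<open>card X * card P ^ a\<close>.\<close>
    then have "(\<Sum>c\<in>X. card (annih \<omega> X (c # cs)) ^ a) * 2 ^ a =
        (\<Sum>c\<in>X - U. (2 * card (annih \<omega> X (c # cs))) ^ a) + (\<Sum>c\<in>U. card (annih \<omega> X (c # cs)) ^ a) * 2 ^ a"
      by (simp only: add_mult_distrib power_mult_distrib sum_distrib_right mult.commute[of "2 ^ a"])
    also have "(\<Sum>c\<in>X - U. (2 * card (annih \<omega> X (c # cs))) ^ a) = card (X - U) * card P ^ a"
      using not_in_U by simp
    also have "(\<Sum>c\<in>U. card (annih \<omega> X (c # cs)) ^ a) * 2 ^ a = (card U * 2 ^ a) * card P ^ a"
      using in_U by simp
    also have "card (X - U) * card P ^ a + (card U * 2 ^ a) * card P ^ a \<le> card X * card P ^ a + card X * card P ^ a"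
      using card_mono[OF fX Diff_subset] U by (intro add_mono mult_le_mono1)
    finally show ?thesis by (simp add: P_def)
  qed
  have "(\<Sum>cs\<in>tuples X (Suc j). card (annih \<omega> X cs) ^ a) * 2 ^ (a * Suc j)
      = (\<Sum>cs\<in>tuples X j. (\<Sum>c\<in>X. card (annih \<omega> X (c # cs)) ^ a) * 2 ^ a) * 2 ^ (a * j)"
    by (simp only: sum_tuples_Suc[OF fX] mult_Suc_right power_add mult.assoc[symmetric] flip: sum_distrib_right)
  also have "\<dots> \<le> (\<Sum>cs\<in>tuples X j. 2 * card X * card (annih \<omega> X cs) ^ a) * 2 ^ (a * j)"
    by (intro mult_le_mono1 sum_mono step)
  also have "\<dots> = 2 * card X * ((\<Sum>cs\<in>tuples X j. card (annih \<omega> X cs) ^ a) * 2 ^ (a * j))"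
    by (simp only: sum_distrib_left[symmetric] mult.assoc)
  also have "\<dots> \<le> 2 * card X * (2 ^ j * card X ^ (j + a))"
    by (intro mult_le_mono2 Suc.IH) (use Suc.prems in simp)
  also have "\<dots> = 2 ^ Suc j * card X ^ (Suc j + a)" by simp
  finally show ?case .
qed simp

text \<open>Linear independence modulo the radical of the pairing, by cardinalities: each entry halves the annihilator.\<close>

definition indep :: "('a \<Rightarrow> 'b \<Rightarrow> bit) \<Rightarrow> 'b set \<Rightarrow> 'a list \<Rightarrow> bool" where
  "indep \<beta> X cs \<longleftrightarrow> card X = 2 ^ length cs * card (annih \<beta> X cs)"

text \<open>The entries are chosen one after another. At most \<open>2 ^ j\<close> candidates fail
  to halve the annihilator of the \<open>j\<close> earlier ones, and for \<open>j < t\<close> this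
  is at most half of \<open>2 ^ t\<close>, so at least \<open>2 ^ (t - 1)\<close> good choices
  remain each time.\<close>

lemma card_indep_ge:
  assumes X: "finite_subgroup X" and \<beta>: "biadditive \<beta>" and C: "finite_subgroup C" "card C = card X"
    and nondeg: "\<And>x. x \<in> X \<Longrightarrow> \<forall>c\<in>C. \<beta> c x = 0 \<Longrightarrow> x = 0"
    and N: "N \<subseteq> C" "2 ^ t \<le> card N" and "j \<le> t"
  shows "2 ^ (t * j) \<le> 2 ^ j * card {cs\<in>tuples N j. indep \<beta> X cs}"
  using \<open>j \<le> t\<close>
proof (induction j)
  case 0
  have "{cs\<in>tuples N 0. indep \<beta> X cs} = {[]}" by (auto simp: indep_def)
  then show ?case by simp
next
  case (Suc j)
  have fC: "finite C" using C by (auto simp: finite_subgroup_def)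
  then have fN: "finite N" using N finite_subset by blast
  have rad: "{x\<in>X. \<forall>c\<in>C. \<beta> c x = 0} \<subseteq> {0}" using nondeg by auto
  let ?I = "\<lambda>j. {cs\<in>tuples N j. indep \<beta> X cs}"
  have step: "2 ^ t \<le> 2 * card {c\<in>N. indep \<beta> X (c # cs)}" if cs: "cs \<in> ?I j" for cs
  proof -
    define P where "P = annih \<beta> X cs"
    define U where "U = {c\<in>C. \<forall>x\<in>P. \<beta> c x = 0}"
    have Pc: "finite_subgroup P" unfolding P_def by (rule annih_closed[OF X \<beta>])
    have Ppos: "card P > 0" using Pc by (auto simp: finite_subgroup_def card_gt_0_iff)
    have ind: "card X = 2 ^ j * card P" using cs by (auto simp: tuples_def indep_def P_def)
    have "card U * card P \<le> card C * card {x\<in>X. \<forall>c\<in>C. \<beta> c x = 0}"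
      unfolding U_def P_def by (rule card_stabilizers[OF X \<beta> C(1)])
    also have "\<dots> \<le> card C * 1" using card_mono[OF _ rad] by (intro mult_le_mono2) simp
    finally have "card U * card P \<le> 2 ^ j * card P" using C ind by simp
    then have "card U \<le> 2 ^ j" using Ppos by simp
    then have "2 * card U \<le> 2 ^ Suc j" by simp
    also have "\<dots> \<le> 2 ^ t" using Suc.prems by (intro power_increasing) auto
    finally have U: "2 * card U \<le> 2 ^ t" .
    have sub: "N - U \<subseteq> {c\<in>N. indep \<beta> X (c # cs)}"
    proof
      fix c assume c: "c \<in> N - U"
      have "2 * card (annih \<beta> X (c # cs)) = card P"
        unfolding annih_Cons P_def[symmetric] using c N
        by (intro card_hyperplane[OF Pc \<beta>]) (auto simp: U_def)
      then have "indep \<beta> X (c # cs)" using ind cs by (auto simp: indep_def tuples_def)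
      then show "c \<in> {c\<in>N. indep \<beta> X (c # cs)}" using c by simp
    qed
    have "card N - card U \<le> card (N - U)"
      by (rule diff_card_le_card_Diff) (use fC in \<open>auto simp: U_def\<close>)
    also have "\<dots> \<le> card {c\<in>N. indep \<beta> X (c # cs)}" using fN by (intro card_mono sub) auto
    finally show ?thesis using U N by linarith
  qed
  have "(2::nat) ^ (t * Suc j) = 2 ^ (t * j) * 2 ^ t" by (simp add: power_add)
  also have "\<dots> \<le> 2 ^ j * card (?I j) * 2 ^ t" using Suc by (intro mult_le_mono1) auto
  also have "\<dots> = 2 ^ j * (\<Sum>cs\<in>?I j. 2 ^ t)" by simp
  also have "\<dots> \<le> 2 ^ j * (\<Sum>cs\<in>?I j. 2 * card {c\<in>N. indep \<beta> X (c # cs)})"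
    by (intro mult_le_mono2 sum_mono step)
  also have "\<dots> = 2 ^ Suc j * card (\<Union>cs\<in>?I j. (\<lambda>c. c # cs) ` {c\<in>N. indep \<beta> X (c # cs)})"
    using fN by (subst card_UN_disjoint) (auto simp: card_image inj_on_def sum_distrib_left mult_ac)
  also have "\<dots> \<le> 2 ^ Suc j * card (?I (Suc j))"
    using fN by (intro mult_le_mono2 card_mono finite_subset[OF _ finite_tuples[OF fN, of "Suc j"]])
      (auto simp: tuples_def)
  finally show ?case .
qed

section \<open>Binary vectors and the symplectic form\<close>

definition bvecs :: "nat set \<Rightarrow> (nat \<Rightarrow> bit) set" where
  "bvecs T = {v. \<forall>i. i \<notin> T \<longrightarrow> v i = 0}"

definition dot :: "nat set \<Rightarrow> (nat \<Rightarrow> bit) \<Rightarrow> (nat \<Rightarrow> bit) \<Rightarrow> bit" where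
  "dot T v w = (\<Sum>i\<in>T. v i * w i)"

lemma bij_bvecs: "bij_betw (\<lambda>S i. of_bool (i \<in> S)) (Pow T) (bvecs T)"
  by (rule bij_betw_byWitness[where f' = "\<lambda>v. {i. v i = 1}"])
    (auto simp: bvecs_def fun_eq_iff)

lemma card_bvecs: "finite T \<Longrightarrow> card (bvecs T) = 2 ^ card T"
  using bij_betw_same_card[OF bij_bvecs, of T] by (simp add: card_Pow)

lemma finite_bvecs [simp]: "finite T \<Longrightarrow> finite (bvecs T)"
  using bij_betw_finite[OF bij_bvecs, of T] by simp

lemma finite_subgroup_bvecs: "finite T \<Longrightarrow> finite_subgroup (bvecs T)"
  by (simp add: finite_subgroup_def) (simp add: bvecs_def)

lemma bvec_add_self: "(v :: nat \<Rightarrow> bit) + v = 0"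
  by (auto simp: fun_eq_iff bit_add_self)

lemma dot_commute: "dot T v w = dot T w v"
  by (simp add: dot_def mult.commute)

lemma biadditive_dot: "biadditive (dot T)"
  by (simp add: biadditive_def dot_def distrib_left distrib_right sum.distrib)

lemma dot_nondegenerate:
  assumes "finite T" "x \<in> bvecs T" "\<forall>c\<in>bvecs T. dot T c x = 0"
  shows "x = 0"
proof
  fix i
  show "x i = 0 i"
  proof (cases "i \<in> T")
    case True
    then have "(\<lambda>j. of_bool (j = i)) \<in> bvecs T" by (auto simp: bvecs_def)
    then have "dot T (\<lambda>j. of_bool (j = i)) x = 0" using assms by blast
    then show ?thesis using True \<open>finite T\<close> by (simp add: dot_def if_distrib[of "\<lambda>b. b * _"] of_bool_def cong: if_cong)
  next
    case False
    then show ?thesis using assms by (simp add: bvecs_def)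
  qed
qed

text \<open>First moment method: an isotropic kernel contains at least \<open>2^(4a^2 - 2a)\<close> independent \<open>2a\<close>-tuples,
  all of which have mutually orthogonal halves.\<close>

lemma card_isotropic_kernel:
  fixes \<omega> :: "(nat \<Rightarrow> bit) \<Rightarrow> (nat \<Rightarrow> bit) \<Rightarrow> bit"
  assumes T: "finite T" "card T = n + 2 * a" and \<omega>: "biadditive \<omega>"
    and rad: "card {x\<in>bvecs T. \<forall>c\<in>bvecs T. \<omega> c x = 0} * 4 ^ a \<le> card (bvecs T)"
  shows "card {ys\<in>tuples (bvecs T) n. \<forall>c\<in>annih (dot T) (bvecs T) ys. \<forall>c'\<in>annih (dot T) (bvecs T) ys. \<omega> c c' = 0}
     * 2 ^ (a * a) \<le> 2 ^ (3 * a) * card (bvecs T) ^ n"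
proof -
  define X where "X = bvecs T"
  \<comment> \<open>With \<open>ys\<close> read as the columns of a matrix whose rows are indexed by
    \<open>T\<close>, \<open>ker ys\<close> is its left kernel. Below, \<open>Z\<close> holds the
    matrices with isotropic kernel, and \<open>Q\<close> retains from isotropy only that the first
    half of the tuple is orthogonal to the second.\<close>
  define ker where "ker = annih (dot T) X"
  define Z where "Z = {ys\<in>tuples X n. \<forall>c\<in>ker ys. \<forall>c'\<in>ker ys. \<omega> c c' = 0}"
  define I where "I = (\<lambda>ys. {zs\<in>tuples (ker ys) (2 * a). indep (dot T) X zs})"
  define Q where "Q = {zs\<in>tuples X (2 * a). indep (dot T) X zs \<and>
      (\<forall>c\<in>set (take a zs). \<forall>d\<in>set (drop a zs). \<omega> c d = 0)}"
  have X: "finite_subgroup X" and fX: "finite X" using T by (auto simp: X_def finite_subgroup_bvecs)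
  have cX: "card X = 2 ^ (n + 2 * a)" using T by (simp add: X_def card_bvecs)
  have kerX: "ker ys \<subseteq> X" for ys by (auto simp: ker_def annih_def)
  have fZ: "finite Z" using fX by (simp add: Z_def)
  have fQ: "finite Q" using fX by (simp add: Q_def)
  have fI: "finite (I ys)" for ys using finite_subset[OF kerX fX] by (simp add: I_def)
  have I: "2 ^ (2 * a * (2 * a)) \<le> 2 ^ (2 * a) * card (I ys)" if "ys \<in> Z" for ys
    unfolding I_def
  proof (rule card_indep_ge[OF X biadditive_dot X refl _ kerX _ order_refl])
    show "x = 0" if "x \<in> X" "\<forall>c\<in>X. dot T c x = 0" for x
      using dot_nondegenerate[OF T(1)] that by (simp add: X_def)
    have "card X \<le> 2 ^ n * card (ker ys)"
      using card_annih_ge[OF X biadditive_dot, of ys] that by (simp add: Z_def tuples_def ker_def)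
    then show "2 ^ (2 * a) \<le> card (ker ys)" by (simp add: cX power_add)
  qed
  \<comment> \<open>The pairs of a matrix in \<open>Z\<close> and an independent tuple in its kernel
    are counted in two ways; first from below, matrix by matrix.\<close>
  have "card Z * 2 ^ (2 * a * (2 * a)) = (\<Sum>ys\<in>Z. 2 ^ (2 * a * (2 * a)))" by simp
  also have "\<dots> \<le> (\<Sum>ys\<in>Z. 2 ^ (2 * a) * card (I ys))" by (intro sum_mono I)
  also have "\<dots> = 2 ^ (2 * a) * card (SIGMA ys:Z. I ys)"
    using fZ fI by (simp add: sum_distrib_left)
  finally have 1: "card Z * 2 ^ (2 * a * (2 * a)) \<le> 2 ^ (2 * a) * card (SIGMA ys:Z. I ys)" .
  \<comment> \<open>The same pairs, tuple by tuple: since \<open>dot\<close> is symmetric, the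
    columns lie in the annihilator of the tuple.\<close>
  have "card (SIGMA ys:Z. I ys) \<le> card (SIGMA zs:Q. tuples (annih (dot T) X zs) n)"
  proof (rule card_inj_on_le[where f = "\<lambda>(x, y). (y, x)"])
    show "finite (SIGMA zs:Q. tuples (annih (dot T) X zs) n)"
      using fQ fX by (intro finite_SigmaI finite_tuples) (auto simp: annih_def)
    show "(\<lambda>(x, y). (y, x)) ` (SIGMA ys:Z. I ys) \<subseteq> (SIGMA zs:Q. tuples (annih (dot T) X zs) n)"
    proof clarify
      fix ys zs assume ys: "ys \<in> Z" and zs: "zs \<in> I ys"
      have s: "set zs \<subseteq> ker ys" using zs by (simp add: I_def tuples_def)
      have "zs \<in> Q" unfolding Q_def
      proof (intro CollectI conjI ballI)
        show "zs \<in> tuples X (2 * a)" using zs kerX by (auto simp: I_def tuples_def)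
        show "indep (dot T) X zs" using zs by (simp add: I_def)
        fix c d assume "c \<in> set (take a zs)" "d \<in> set (drop a zs)"
        then have "c \<in> ker ys" "d \<in> ker ys" using s in_set_takeD in_set_dropD by fast+
        then show "\<omega> c d = 0" using ys by (simp add: Z_def)
      qed
      moreover have "ys \<in> tuples (annih (dot T) X zs) n"
        using ys s dot_commute[of T] by (auto simp: Z_def tuples_def ker_def annih_def subset_iff) metis
      ultimately show "zs \<in> Q \<and> ys \<in> tuples (annih (dot T) X zs) n" by simp
    qed
  qed (auto simp: inj_on_def)
  also have "\<dots> = (\<Sum>zs\<in>Q. card (annih (dot T) X zs) ^ n)"
    using fQ fX by (subst card_SigmaI) (auto simp: annih_def card_tuples)
  finally have "card (SIGMA ys:Z. I ys) * 2 ^ (2 * a * n) \<le> (\<Sum>zs\<in>Q. card (annih (dot T) X zs) ^ n) * 2 ^ (2 * a * n)"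
    by (rule mult_le_mono1)
  also have "\<dots> = (\<Sum>zs\<in>Q. (2 ^ (2 * a) * card (annih (dot T) X zs)) ^ n)"
    unfolding power_mult[of 2 "2 * a" n] sum_distrib_right by (simp add: power_mult_distrib mult.commute)
  \<comment> \<open>Independence makes the annihilator smaller than \<open>X\<close> by exactly the
    factor \<open>2 ^ (2 * a)\<close>, once for each of the \<open>n\<close> columns.\<close>
  also have "\<dots> = (\<Sum>zs\<in>Q. card X ^ n)"
    by (intro sum.cong refl arg_cong[where f = "\<lambda>x. x ^ n"]) (auto simp: Q_def indep_def tuples_def)
  finally have 2: "card (SIGMA ys:Z. I ys) * 2 ^ (2 * a * n) \<le> card Q * card X ^ n" by simp
  \<comment> \<open>Cutting a tuple in the middle gives an \<open>a\<close>-tuple and a second one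
    in its annihilator under \<open>\<omega>\<close>, as counted by
    \<open>sum_card_annih_pow\<close>.\<close>
  have "card Q \<le> card (SIGMA cs:tuples X a. tuples (annih \<omega> X cs) a)"
  proof (rule card_inj_on_le[where f = "\<lambda>zs. (take a zs, drop a zs)"])
    show "inj_on (\<lambda>zs. (take a zs, drop a zs)) Q"
      by (rule inj_onI) (metis append_take_drop_id prod.inject)
    show "(\<lambda>zs. (take a zs, drop a zs)) ` Q \<subseteq> (SIGMA cs:tuples X a. tuples (annih \<omega> X cs) a)"
    proof (rule image_subsetI)
      fix zs assume zs: "zs \<in> Q"
      then have "set (take a zs) \<subseteq> X" "set (drop a zs) \<subseteq> X" "length zs = 2 * a"
        using set_take_subset[of a zs] set_drop_subset[of a zs] by (auto simp: Q_def tuples_def)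
      then show "(take a zs, drop a zs) \<in> (SIGMA cs:tuples X a. tuples (annih \<omega> X cs) a)"
        using zs by (auto simp: tuples_def annih_def Q_def)
    qed
    show "finite (SIGMA cs:tuples X a. tuples (annih \<omega> X cs) a)"
      using fX by (intro finite_SigmaI finite_tuples) (auto simp: annih_def)
  qed
  also have "\<dots> = (\<Sum>cs\<in>tuples X a. card (annih \<omega> X cs) ^ a)"
    using fX by (subst card_SigmaI) (auto simp: annih_def card_tuples)
  finally have "card Q * 2 ^ (a * a) \<le> (\<Sum>cs\<in>tuples X a. card (annih \<omega> X cs) ^ a) * 2 ^ (a * a)"
    by (rule mult_le_mono1)
  also have "\<dots> \<le> 2 ^ a * card X ^ (a + a)"
    using rad by (intro sum_card_annih_pow[OF X \<omega>]) (auto simp: X_def)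
  finally have 3: "card Q * 2 ^ (a * a) \<le> 2 ^ a * card X ^ (a + a)" .
  \<comment> \<open>The number of all \<open>2a\<close>-tuples is the product of the two powers of 2
    on the left of the first two bounds, so these cancel and only \<open>2 ^ (a * a)\<close> against
    \<open>2 ^ (3 * a)\<close> survives.\<close>
  have pw: "card X ^ (a + a) = 2 ^ (2 * a * (2 * a)) * 2 ^ (2 * a * n)"
    unfolding cX power_mult[symmetric] power_add[symmetric] by (simp add: algebra_simps)
  let ?u = "(2::nat) ^ (2 * a * (2 * a))" and ?v = "(2::nat) ^ (2 * a * n)" and ?w = "(2::nat) ^ (a * a)"
  have "(card Z * ?w) * (?u * ?v) = (card Z * ?u) * (?v * ?w)" by (simp only: mult_ac)
  also have "\<dots> \<le> (2 ^ (2 * a) * card (SIGMA ys:Z. I ys)) * (?v * ?w)" by (rule mult_le_mono1[OF 1])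
  also have "\<dots> = 2 ^ (2 * a) * ?w * (card (SIGMA ys:Z. I ys) * ?v)" by (simp only: mult_ac)
  also have "\<dots> \<le> 2 ^ (2 * a) * ?w * (card Q * card X ^ n)" by (rule mult_le_mono2[OF 2])
  also have "\<dots> = 2 ^ (2 * a) * card X ^ n * (card Q * ?w)" by (simp only: mult_ac)
  also have "\<dots> \<le> 2 ^ (2 * a) * card X ^ n * (2 ^ a * card X ^ (a + a))" by (rule mult_le_mono2[OF 3])
  also have "\<dots> = 2 ^ (2 * a + a) * card X ^ n * (?u * ?v)" unfolding pw power_add[of 2 "2 * a" a] by (simp only: mult_ac)
  finally have "card Z * ?w \<le> 2 ^ (2 * a + a) * card X ^ n" by simp
  then show ?thesis by (simp add: Z_def ker_def X_def)
qed

section \<open>The symplectic form and row combinations\<close>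

lemma sum_lessThan_double: "sum f {..<2 * n} = sum f {..<n} + (\<Sum>i<n. f (n + i))"
  for f :: "nat \<Rightarrow> 'a::comm_monoid_add"
proof -
  have "sum f {..<2 * n} = sum f {..<n} + sum f {n..<2 * n}"
    by (subst sum.union_disjoint[symmetric]) (auto intro!: sum.cong)
  also have "sum f {n..<2 * n} = (\<Sum>i<n. f (n + i))"
    using sum.shift_bounds_nat_ivl[of f 0 n n] by (simp add: mult_2 lessThan_atLeast0 add.commute)
  finally show ?thesis .
qed

text \<open>The vector-matrix product \<open>c b\<close>, where \<open>b i\<close> is the row with
  index \<open>i\<close>.\<close>

definition row_comb :: "nat set \<Rightarrow> (nat \<Rightarrow> nat \<Rightarrow> bit) \<Rightarrow> (nat \<Rightarrow> bit) \<Rightarrow> nat \<Rightarrow> bit" where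
  "row_comb T b c = (\<lambda>l. \<Sum>i\<in>T. c i * b i l)"

text \<open>The matrix of the standard symplectic form, acting on a vector; over the field with two
  elements it carries no sign and is an involution.\<close>

definition half_swap :: "nat \<Rightarrow> (nat \<Rightarrow> bit) \<Rightarrow> nat \<Rightarrow> bit" where
  "half_swap n u = (\<lambda>l. if l < n then u (n + l) else if l < 2 * n then u (l - n) else 0)"

definition symp :: "nat \<Rightarrow> (nat \<Rightarrow> bit) \<Rightarrow> (nat \<Rightarrow> bit) \<Rightarrow> bit" where
  "symp n u v = dot {..<2 * n} (half_swap n u) v"

lemma row_comb_add: "row_comb T b (c + d) = row_comb T b c + row_comb T b d"
  by (simp add: row_comb_def fun_eq_iff distrib_right sum.distrib)

lemma half_swap_add: "half_swap n (u + v) = half_swap n u + half_swap n v"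
  by (simp add: half_swap_def fun_eq_iff)

lemma half_swap_in: "half_swap n u \<in> bvecs {..<2 * n}"
  by (auto simp: half_swap_def bvecs_def)

lemma half_swap_half_swap: "u \<in> bvecs {..<2 * n} \<Longrightarrow> half_swap n (half_swap n u) = u"
  by (auto simp: half_swap_def bvecs_def fun_eq_iff)

lemma biadditive_symp: "biadditive (symp n)"
  using biadditive_dot[of "{..<2 * n}"] by (simp add: biadditive_def symp_def half_swap_add)

lemma row_comb_in: "(\<And>i. i \<in> T \<Longrightarrow> b i \<in> bvecs J) \<Longrightarrow> row_comb T b c \<in> bvecs J"
  by (auto simp: row_comb_def bvecs_def)

text \<open>A nonempty fibre is mapped injectively into the kernel by adding one of its points,
  because every vector is its own negative.\<close>

lemma card_vimage_additive:
  fixes f :: "(nat \<Rightarrow> bit) \<Rightarrow> (nat \<Rightarrow> bit)"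
  assumes X: "finite_subgroup X" and f: "\<And>x y. f (x + y) = f x + f y" and E: "finite E"
  shows "card {x\<in>X. f x \<in> E} \<le> card E * card {x\<in>X. f x = 0}"
proof -
  have fX: "finite X" using X by (simp add: finite_subgroup_def)
  have fib: "card {x\<in>X. f x = e} \<le> card {x\<in>X. f x = 0}" for e
  proof (cases "\<exists>x0\<in>X. f x0 = e")
    case True
    then obtain x0 where x0: "x0 \<in> X" "f x0 = e" by blast
    show ?thesis
      by (rule card_inj_on_le[where f = "\<lambda>x. x + x0"])
        (use X x0 fX in \<open>auto simp: inj_on_def finite_subgroup_def f bvec_add_self\<close>)
  next
    case False
    then have "{x\<in>X. f x = e} = {}" by blast
    then show ?thesis by (simp only: card.empty)
  qed
  have "card {x\<in>X. f x \<in> E} = card (\<Union>e\<in>E. {x\<in>X. f x = e})" by (rule arg_cong[where f = card]) auto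
  also have "\<dots> \<le> (\<Sum>e\<in>E. card {x\<in>X. f x = e})" by (rule card_UN_le[OF E])
  also have "\<dots> \<le> (\<Sum>e\<in>E. card {x\<in>X. f x = 0})" by (intro sum_mono fib)
  finally show ?thesis by simp
qed

text \<open>Contains the restriction to the rows in \<open>T\<close> of every product \<open>BA\<close> with \<open>A\<close> isotropic of full rank
  and with rows \<open>b i\<close> of \<open>B\<close> for \<open>i \<in> T\<close>; a matrix is given by the list of its columns.\<close>

definition shadow :: "nat \<Rightarrow> nat set \<Rightarrow> (nat \<Rightarrow> nat \<Rightarrow> bit) \<Rightarrow> (nat \<Rightarrow> bit) list set" where
  "shadow n T b = {ys\<in>tuples (bvecs T) n.
     (\<forall>c\<in>bvecs T. row_comb T b c = 0 \<longrightarrow> (\<forall>y\<in>set ys. dot T c y = 0)) \<and>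
     (\<forall>c\<in>annih (dot T) (bvecs T) ys. \<forall>c'\<in>annih (dot T) (bvecs T) ys.
        symp n (row_comb T b c) (row_comb T b c') = 0)}"

text \<open>Dichotomy at \<open>2 ^ a\<close> relations among the rows \<open>b\<close>. Many
  relations confine the columns to a small subspace; few relations make the radical of the
  pulled-back form small enough for \<open>card_isotropic_kernel\<close>.\<close>

lemma card_shadow:
  assumes T: "finite T" "card T = n + 2 * a" and "a \<le> n"
    and b: "\<And>i. i \<in> T \<Longrightarrow> b i \<in> bvecs {..<2 * n}"
  shows "card (shadow n T b) * 2 ^ (a * a) \<le> 2 ^ (3 * a) * card (bvecs T) ^ n"
proof -
  define X where "X = bvecs T"
  define K where "K = {c\<in>X. row_comb T b c = 0}"
  define \<omega> where "\<omega> = (\<lambda>c c'. symp n (row_comb T b c) (row_comb T b c'))"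
  have X: "finite_subgroup X" and fX: "finite X" using T by (auto simp: X_def finite_subgroup_bvecs)
  have cX: "card X = 2 ^ (n + 2 * a)" using T by (simp add: X_def card_bvecs)
  have \<omega>: "biadditive \<omega>" using biadditive_symp[of n] by (simp add: \<omega>_def biadditive_def row_comb_add)
  have K: "finite_subgroup K"
    using X by (auto simp: K_def finite_subgroup_def row_comb_add) (simp add: row_comb_def fun_eq_iff)
  show ?thesis
  proof (cases "2 ^ a \<le> card K")
    \<comment> \<open>Many relations among the rows \<open>b\<close>: already their being relations of the columns is unlikely.\<close>
    case True
    define P where "P = {x\<in>X. \<forall>w\<in>K. dot T w x = 0}"
    have rad0: "{w\<in>K. \<forall>x\<in>X. dot T w x = 0} \<subseteq> {0}"
      using dot_nondegenerate[OF T(1)] by (auto simp: K_def X_def dot_commute)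
    have "card K * card P = card X * card {w\<in>K. \<forall>x\<in>X. dot T w x = 0}"
      unfolding P_def by (rule pairing_card[OF X K biadditive_dot])
    also have "\<dots> \<le> card X * 1" using card_mono[OF _ rad0] by (intro mult_le_mono2) simp
    finally have P: "card P * 2 ^ a \<le> card X"
      using mult_le_mono1[OF True, of "card P"] by (simp only: mult.commute nat_mult_1_right)
    have fP: "finite P" using fX by (simp add: P_def)
    have "shadow n T b \<subseteq> tuples P n"
      by (auto simp: shadow_def tuples_def P_def X_def K_def)
    then have "card (shadow n T b) \<le> card P ^ n"
      using card_mono[OF finite_tuples[OF fP]] card_tuples[OF fP] by metis
    \<comment> \<open>Each of the \<open>n\<close> columns gains a factor \<open>2 ^ a\<close>, and
      \<open>a \<le> n\<close> turns this into at least \<open>2 ^ (a * a)\<close>.\<close>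
    then have "card (shadow n T b) * 2 ^ (a * a) \<le> card P ^ n * 2 ^ (a * n)"
      using \<open>a \<le> n\<close> by (intro mult_le_mono power_increasing) auto
    also have "\<dots> = (card P * 2 ^ a) ^ n" by (simp add: power_mult_distrib power_mult)
    also have "\<dots> \<le> card X ^ n" by (rule power_mono[OF P]) simp
    also have "\<dots> \<le> 2 ^ (3 * a) * card X ^ n" by simp
    finally show ?thesis by (simp add: X_def)
  next
    \<comment> \<open>The row space is large, hence so is the rank of the form \<open>\<omega>\<close>.\<close>
    case False
    define J where "J = {..<2 * n}"
    define \<beta> where "\<beta> = (\<lambda>c x. dot J (row_comb T b c) x)"
    \<comment> \<open>The orthogonal complement of the row space of \<open>b\<close>. As few
      relations hold, the row space is large and \<open>E\<close> is small.\<close>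
    define E where "E = {x\<in>bvecs J. \<forall>c\<in>X. \<beta> c x = 0}"
    have J: "finite J" "card J = 2 * n" by (auto simp: J_def)
    have \<beta>: "biadditive \<beta>" using biadditive_dot[of J] by (simp add: \<beta>_def biadditive_def row_comb_add)
    have "{c\<in>X. \<forall>x\<in>bvecs J. \<beta> c x = 0} \<subseteq> K"
    proof
      fix c assume c: "c \<in> {c\<in>X. \<forall>x\<in>bvecs J. \<beta> c x = 0}"
      have "row_comb T b c = 0"
        by (rule dot_nondegenerate[OF J(1) row_comb_in[of T b J c]])
          (use b c in \<open>auto simp: J_def \<beta>_def dot_commute\<close>)
      then show "c \<in> K" using c by (simp add: K_def)
    qed
    then have le: "card {c\<in>X. \<forall>x\<in>bvecs J. \<beta> c x = 0} \<le> card K"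
      using K by (intro card_mono) (auto simp: finite_subgroup_def)
    have "card X * card E = card (bvecs J) * card {c\<in>X. \<forall>x\<in>bvecs J. \<beta> c x = 0}"
      unfolding E_def by (rule pairing_card[OF finite_subgroup_bvecs[OF J(1)] X \<beta>])
    also have "\<dots> \<le> 4 ^ n * card K" using le J by (simp add: card_bvecs power_mult)
    finally have XE: "card X * card E \<le> 4 ^ n * card K" .
    have fE: "finite E" using J by (simp add: E_def)
    \<comment> \<open>An element of the radical of \<open>\<omega>\<close> has a row combination
      that \<open>half_swap\<close> sends into \<open>E\<close>; its fibres under this map have at
      most \<open>card K\<close> elements.\<close>
    have "{x\<in>X. \<forall>c\<in>X. \<omega> c x = 0} \<subseteq> {x\<in>X. half_swap n (row_comb T b x) \<in> E}"
    proof clarify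
      fix x assume x: "x \<in> X" "\<forall>c\<in>X. \<omega> c x = 0"
      have "\<beta> c (half_swap n (row_comb T b x)) = \<omega> c x" for c
      proof -
        show ?thesis unfolding \<beta>_def \<omega>_def symp_def dot_def J_def sum_lessThan_double
          by (simp add: half_swap_def add.commute mult.commute)
      qed
      then show "half_swap n (row_comb T b x) \<in> E"
        using x half_swap_in by (simp add: E_def J_def)
    qed
    then have "card {x\<in>X. \<forall>c\<in>X. \<omega> c x = 0} \<le> card {x\<in>X. half_swap n (row_comb T b x) \<in> E}"
      using fX by (intro card_mono) auto
    also have "\<dots> \<le> card E * card {x\<in>X. half_swap n (row_comb T b x) = 0}"
      by (rule card_vimage_additive[OF X _ fE]) (simp add: row_comb_add half_swap_add)
    also have "{x\<in>X. half_swap n (row_comb T b x) = 0} = K"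
    proof -
      have z: "half_swap n 0 = 0" by (simp add: half_swap_def fun_eq_iff)
      have "row_comb T b x = 0" if "half_swap n (row_comb T b x) = 0" for x
        using half_swap_half_swap[OF row_comb_in[of T b "{..<2 * n}" x]] b that z by simp
      then show ?thesis using z by (auto simp: K_def)
    qed
    finally have R: "card {x\<in>X. \<forall>c\<in>X. \<omega> c x = 0} \<le> card E * card K" .
    have K2: "card K \<le> 2 ^ a" using False by simp
    have "card X * (card {x\<in>X. \<forall>c\<in>X. \<omega> c x = 0} * 4 ^ a) \<le> card X * (card E * card K * 4 ^ a)"
      using R by (intro mult_le_mono2 mult_le_mono1)
    also have "\<dots> = (card X * card E) * (card K * 4 ^ a)" by (simp only: mult_ac)
    also have "\<dots> \<le> (4 ^ n * card K) * (card K * 4 ^ a)" by (rule mult_le_mono1[OF XE])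
    also have "\<dots> \<le> (4 ^ n * 2 ^ a) * (2 ^ a * 4 ^ a)" using K2 by (intro mult_le_mono order_refl)
    \<comment> \<open>Both sides are \<open>2 ^ (2 * n + 4 * a)\<close>: the threshold
      \<open>2 ^ a\<close> for \<open>K\<close> is matched to the excess \<open>2 * a\<close> of
      rows over \<open>n\<close>.\<close>
    also have "\<dots> = card X * card X"
    proof -
      have four: "(4::nat) = 2 ^ 2" by simp
      show ?thesis unfolding cX four power_mult[symmetric] power_add[symmetric]
        by (rule arg_cong[where f = "(^) 2"]) simp
    qed
    finally have "card {x\<in>X. \<forall>c\<in>X. \<omega> c x = 0} * 4 ^ a \<le> card X" by (simp add: cX)
    then have main: "card {ys\<in>tuples X n. \<forall>c\<in>annih (dot T) X ys. \<forall>c'\<in>annih (dot T) X ys. \<omega> c c' = 0}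
        * 2 ^ (a * a) \<le> 2 ^ (3 * a) * card X ^ n"
      using card_isotropic_kernel[OF T \<omega>] by (simp add: X_def)
    have "card (shadow n T b) \<le> card {ys\<in>tuples X n. \<forall>c\<in>annih (dot T) X ys. \<forall>c'\<in>annih (dot T) X ys. \<omega> c c' = 0}"
      using fX by (intro card_mono) (auto simp: shadow_def X_def \<omega>_def)
    then show ?thesis using main by (simp add: X_def) (meson le_trans mult_le_mono1)
  qed
qed

section \<open>The distinguishing event\<close>

lemma dot_row_comb: "dot J (row_comb T b c) w = (\<Sum>i\<in>T. c i * dot J (b i) w)"
  unfolding dot_def row_comb_def sum_distrib_right sum_distrib_left
  by (subst sum.swap) (simp only: mult.assoc)

lemma half_swap_row_comb: "half_swap n (row_comb T b c) = row_comb T (\<lambda>i. half_swap n (b i)) c"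
  by (auto simp: half_swap_def row_comb_def fun_eq_iff)

lemma symp_annihilator_lagrangian:
  assumes A: "\<And>j. j < n \<Longrightarrow> A j \<in> bvecs {..<2 * n}"
    and inj: "\<And>x. x \<in> bvecs {..<n} \<Longrightarrow> row_comb {..<n} A x = 0 \<Longrightarrow> x = 0"
    and iso: "\<And>j j'. j < n \<Longrightarrow> j' < n \<Longrightarrow> symp n (A j) (A j') = 0"
    and u: "u \<in> bvecs {..<2 * n}" "\<And>j. j < n \<Longrightarrow> dot {..<2 * n} (A j) u = 0"
    and v: "v \<in> bvecs {..<2 * n}" "\<And>j. j < n \<Longrightarrow> dot {..<2 * n} (A j) v = 0"
  shows "symp n u v = 0"
proof -
  define J where "J = {..<2 * n}"
  define f where "f = row_comb {..<n} A"
  define C where "C = f ` bvecs {..<n}"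
  define P where "P = {w\<in>bvecs J. \<forall>c\<in>C. dot J c w = 0}"
  have f_add: "f (x + y) = f x + f y" for x y by (simp add: f_def row_comb_add)
  have f_in: "f x \<in> bvecs J" for x unfolding f_def J_def by (rule row_comb_in) (use A in auto)
  have J: "finite J" "card J = 2 * n" by (auto simp: J_def)
  have "inj_on f (bvecs {..<n})"
  proof (rule inj_onI)
    fix x y assume xy: "x \<in> bvecs {..<n}" "y \<in> bvecs {..<n}" "f x = f y"
    have "f (x + y) = 0" unfolding f_add xy(3) by (rule bvec_add_self)
    moreover have "x + y \<in> bvecs {..<n}"
      using finite_subgroup_bvecs[of "{..<n}"] xy by (auto simp: finite_subgroup_def)
    ultimately have "x + y = 0" using inj by (simp add: f_def)
    also have "0 = y + y" by (simp add: bvec_add_self)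
    finally show "x = y" by simp
  qed
  then have cC: "card C = 2 ^ n" unfolding C_def by (simp add: card_image card_bvecs)
  have Csub: "C \<subseteq> bvecs J" using f_in by (auto simp: C_def)
  have C: "finite_subgroup C"
    unfolding finite_subgroup_def
  proof (intro conjI ballI)
    show "finite C" by (simp add: C_def)
    have "f 0 = 0" by (simp add: f_def row_comb_def fun_eq_iff)
    then show "0 \<in> C" unfolding C_def using finite_subgroup_bvecs[of "{..<n}"]
      by (metis finite_subgroup_def finite_lessThan imageI)
    fix c d assume "c \<in> C" "d \<in> C"
    then obtain x y where xy: "x \<in> bvecs {..<n}" "y \<in> bvecs {..<n}" "c = f x" "d = f y" by (auto simp: C_def)
    then have "x + y \<in> bvecs {..<n}"
      using finite_subgroup_bvecs[of "{..<n}"] by (auto simp: finite_subgroup_def)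
    then show "c + d \<in> C" using xy f_add by (metis C_def imageI)
  qed
  have rad0: "{w\<in>C. \<forall>x\<in>bvecs J. dot J w x = 0} \<subseteq> {0}"
    using dot_nondegenerate[OF J(1)] Csub dot_commute[of J] by (auto simp: subset_iff)
  have "card C * card P = card (bvecs J) * card {w\<in>C. \<forall>x\<in>bvecs J. dot J w x = 0}"
    unfolding P_def by (rule pairing_card[OF finite_subgroup_bvecs[OF J(1)] C biadditive_dot])
  also have "\<dots> \<le> card (bvecs J) * 1" using card_mono[OF _ rad0] by (intro mult_le_mono2) simp
  finally have "2 ^ n * card P \<le> 2 ^ n * 2 ^ n" using J by (simp add: cC card_bvecs mult_2 power_add)
  then have cP: "card P \<le> 2 ^ n" by simp
  have in_P: "w \<in> P" if "w \<in> bvecs J" "\<And>j. j < n \<Longrightarrow> dot J (A j) w = 0" for w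
    using that by (auto simp: P_def C_def f_def dot_row_comb)
  have "half_swap n ` C \<subseteq> P"
  proof (rule image_subsetI)
    fix c assume "c \<in> C"
    then obtain x where c: "c = row_comb {..<n} A x" by (auto simp: C_def f_def)
    have "dot J (A j) (half_swap n c) = 0" if "j < n" for j
    proof -
      have "dot J (half_swap n c) (A j) = 0"
        unfolding c half_swap_row_comb dot_row_comb using iso[OF _ that] by (simp add: symp_def J_def)
      then show ?thesis by (simp only: dot_commute)
    qed
    then show "half_swap n c \<in> P" using half_swap_in[of n c] by (intro in_P) (auto simp: J_def)
  qed
  moreover have "card (half_swap n ` C) = 2 ^ n"
  proof -
    have "inj_on (half_swap n) C"
      by (rule inj_on_inverseI[where g = "half_swap n"]) (use Csub half_swap_half_swap in \<open>auto simp: J_def\<close>)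
    then show ?thesis by (simp add: card_image cC)
  qed
  moreover have "finite P" using J by (simp add: P_def)
  ultimately have PC: "half_swap n ` C = P" using cP by (intro card_seteq) auto
  have "u \<in> P" "v \<in> P" using u v by (auto intro!: in_P simp: J_def)
  then obtain c where c: "c \<in> C" "u = half_swap n c" using PC by blast
  then have "half_swap n u = c" using half_swap_half_swap Csub by (auto simp: J_def)
  then show ?thesis using \<open>v \<in> P\<close> c by (simp add: symp_def P_def J_def)
qed

text \<open>The bridge from parities of cardinalities, in which matrix products and ranks are
  defined, to sums of bits.\<close>

lemma of_bool_odd_card:
  assumes "finite S"
  shows "(of_bool (odd (card {x\<in>S. P x})) :: bit) = (\<Sum>x\<in>S. of_bool (P x))"
proof -
  have "of_bool (odd k) = (of_nat k :: bit)" for k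
    by (induction k) (auto simp: bit_add_self)
  then show ?thesis using assms by (simp add: sum.inter_filter[symmetric] of_bool_def)
qed

section \<open>Matrices, light rows and the test on the product\<close>

lemma bij_mats: "bij_betw (\<lambda>S i j. (i, j) \<in> S) (Pow ({..<r} \<times> {..<k})) (mats r k)"
  by (rule bij_betw_byWitness[where f' = "\<lambda>M. {(i, j). M i j}"])
    (auto simp: mats_def fun_eq_iff not_le[symmetric])

lemma card_mats: "card (mats r k) = 2 ^ (r * k)"
  using bij_betw_same_card[OF bij_mats, of r k] by (simp add: card_Pow card_cartesian_product)

lemma finite_mats [simp]: "finite (mats r k)"
  using bij_betw_finite[OF bij_mats, of r k] by simp

definition restr_cols :: "nat \<Rightarrow> nat set \<Rightarrow> bmat \<Rightarrow> (nat \<Rightarrow> bit) list" where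
  "restr_cols n T Y = map (\<lambda>j i. of_bool (i \<in> T \<and> Y i j)) [0..<n]"

lemma restr_cols_in: "restr_cols n T Y \<in> tuples (bvecs T) n"
  by (auto simp: restr_cols_def tuples_def bvecs_def)

text \<open>The symplectic weight: the number of pairs of coordinates \<open>j\<close> and
  \<open>n + j\<close> that are not both zero.\<close>

definition sweight :: "nat \<Rightarrow> (nat \<Rightarrow> bit) \<Rightarrow> nat" where
  "sweight n b = card {j. j < n \<and> (b j = 1 \<or> b (n + j) = 1)}"

definition light :: "nat \<Rightarrow> nat \<Rightarrow> (nat \<Rightarrow> bit) set" where
  "light n q = {b\<in>bvecs {..<2 * n}. sweight n b < q}"

text \<open>The rows \<open>b\<close> are quantified existentially, so that membership depends on
  the product alone and can be evaluated for a uniform matrix as well.\<close>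

definition test_set :: "nat \<Rightarrow> nat \<Rightarrow> nat \<Rightarrow> nat \<Rightarrow> bmat set" where
  "test_set n m a q = {Y\<in>mats m n. \<exists>T b. T \<subseteq> {..<m} \<and> card T = n + 2 * a \<and> b \<in> T \<rightarrow>\<^sub>E light n q \<and>
     restr_cols n T Y \<in> shadow n T b}"

text \<open>A matrix is determined by its rows in \<open>T\<close> and its rows outside; the latter
  are unrestricted and only contribute the missing power of 2.\<close>

lemma card_restr_shadow:
  assumes T: "T \<subseteq> {..<m}" "card T = n + 2 * a" and "a \<le> n"
    and b: "b \<in> T \<rightarrow>\<^sub>E light n q"
  shows "card {Y\<in>mats m n. restr_cols n T Y \<in> shadow n T b} * 2 ^ (a * a) \<le> 2 ^ (3 * a) * 2 ^ (m * n)"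
proof -
  define R where "R = {..<m} - T"
  have fT: "finite T" using T finite_subset by blast
  have fS: "finite (shadow n T b)"
    by (rule finite_subset[of _ "tuples (bvecs T) n"]) (use fT in \<open>auto simp: shadow_def\<close>)
  have "card {Y\<in>mats m n. restr_cols n T Y \<in> shadow n T b} \<le> card (shadow n T b \<times> tuples (bvecs R) n)"
  proof (rule card_inj_on_le[where f = "\<lambda>Y. (restr_cols n T Y, restr_cols n R Y)"])
    show "inj_on (\<lambda>Y. (restr_cols n T Y, restr_cols n R Y)) {Y\<in>mats m n. restr_cols n T Y \<in> shadow n T b}"
    proof (rule inj_onI)
      fix Y Y' assume Y: "Y \<in> {Y\<in>mats m n. restr_cols n T Y \<in> shadow n T b}"
        "Y' \<in> {Y\<in>mats m n. restr_cols n T Y \<in> shadow n T b}"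
        and eq: "(restr_cols n T Y, restr_cols n R Y) = (restr_cols n T Y', restr_cols n R Y')"
      show "Y = Y'"
      proof (intro ext)
        fix i j
        show "Y i j = Y' i j"
        proof (cases "i < m \<and> j < n")
          case True
          have "of_bool (i \<in> V \<and> Y i j) = (of_bool (i \<in> V \<and> Y' i j) :: bit)" if "V = T \<or> V = R" for V
          proof -
            have "restr_cols n V Y ! j = restr_cols n V Y' ! j" using that eq by auto
            then have "(\<lambda>i. of_bool (i \<in> V \<and> Y i j) :: bit) = (\<lambda>i. of_bool (i \<in> V \<and> Y' i j))"
              using True by (simp add: restr_cols_def)
            then show ?thesis by (rule fun_cong)
          qed
          from this[of T] this[of R] show ?thesis using True by (cases "i \<in> T") (auto simp: R_def of_bool_eq_iff)
        next
          case False
          then show ?thesis using Y by (auto simp: mats_def)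
        qed
      qed
    qed
    show "finite (shadow n T b \<times> tuples (bvecs R) n)" using fS by (simp add: R_def)
  qed (auto simp: restr_cols_in)
  also have "\<dots> = card (shadow n T b) * card (bvecs R) ^ n"
    by (simp add: card_cartesian_product card_tuples R_def)
  finally have "card {Y\<in>mats m n. restr_cols n T Y \<in> shadow n T b} * 2 ^ (a * a) \<le>
      (card (shadow n T b) * 2 ^ (a * a)) * card (bvecs R) ^ n"
    using mult_le_mono1 by fastforce
  also have "\<dots> \<le> (2 ^ (3 * a) * card (bvecs T) ^ n) * card (bvecs R) ^ n"
    by (intro mult_le_mono1 card_shadow[OF fT T(2) \<open>a \<le> n\<close>]) (use b in \<open>auto simp: light_def PiE_def Pi_def\<close>)
  also have "\<dots> = 2 ^ (3 * a) * (2 ^ (card T + card R)) ^ n"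
    by (simp add: card_bvecs fT R_def power_add power_mult_distrib)
  also have "card T + card R = m"
    using card_mono[OF finite_lessThan T(1)] card_Diff_subset[OF fT T(1)] by (simp add: R_def)
  finally show ?thesis by (simp add: power_mult)
qed

text \<open>Union bound over the positions \<open>T\<close>, of which there are at most
  \<open>m ^ (n + 2 * a)\<close>, and over the light rows placed there. If
  \<open>n + 2 * a > m\<close>, no \<open>T\<close> exists.\<close>

lemma card_test_set:
  assumes "a \<le> n"
  shows "card (test_set n m a q) * 2 ^ (a * a) \<le>
    m ^ (n + 2 * a) * card (light n q) ^ (n + 2 * a) * 2 ^ (3 * a) * 2 ^ (m * n)"
proof (cases "n + 2 * a \<le> m")
  case True
  let ?k = "n + 2 * a"
  define W where "W = (\<lambda>T b. {Y\<in>mats m n. restr_cols n T Y \<in> shadow n T b})"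
  define \<T> where "\<T> = {T. T \<subseteq> {..<m} \<and> card T = ?k}"
  have fL: "finite (light n q)" by (simp add: light_def)
  have f\<T>: "finite \<T>" by (simp add: \<T>_def)
  have fT: "finite T" if "T \<in> \<T>" for T using that finite_subset by (auto simp: \<T>_def)
  have fP: "finite (T \<rightarrow>\<^sub>E light n q)" if "T \<in> \<T>" for T using fT[OF that] fL by (simp add: finite_PiE)
  have "test_set n m a q = (\<Union>T\<in>\<T>. \<Union>b\<in>T \<rightarrow>\<^sub>E light n q. W T b)"
    by (auto simp: test_set_def \<T>_def W_def)
  then have "card (test_set n m a q) \<le> (\<Sum>T\<in>\<T>. card (\<Union>b\<in>T \<rightarrow>\<^sub>E light n q. W T b))"
    using card_UN_le[OF f\<T>] by simp
  also have "\<dots> \<le> (\<Sum>T\<in>\<T>. \<Sum>b\<in>T \<rightarrow>\<^sub>E light n q. card (W T b))"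
    by (intro sum_mono card_UN_le fP)
  finally have "card (test_set n m a q) * 2 ^ (a * a) \<le> (\<Sum>T\<in>\<T>. \<Sum>b\<in>T \<rightarrow>\<^sub>E light n q. card (W T b)) * 2 ^ (a * a)"
    by (rule mult_le_mono1)
  also have "\<dots> = (\<Sum>T\<in>\<T>. \<Sum>b\<in>T \<rightarrow>\<^sub>E light n q. card (W T b) * 2 ^ (a * a))"
    by (simp add: sum_distrib_right)
  also have "\<dots> \<le> (\<Sum>T\<in>\<T>. \<Sum>b\<in>T \<rightarrow>\<^sub>E light n q. 2 ^ (3 * a) * 2 ^ (m * n))"
    unfolding W_def using assms by (intro sum_mono card_restr_shadow) (auto simp: \<T>_def)
  also have "\<dots> = (\<Sum>T\<in>\<T>. card (light n q) ^ ?k * (2 ^ (3 * a) * 2 ^ (m * n)))"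
    using fT by (intro sum.cong) (auto simp: card_PiE \<T>_def)
  also have "\<dots> = (m choose ?k) * (card (light n q) ^ ?k * (2 ^ (3 * a) * 2 ^ (m * n)))"
    using n_subsets[of "{..<m}" ?k] by (simp add: \<T>_def)
  also have "\<dots> \<le> m ^ ?k * (card (light n q) ^ ?k * (2 ^ (3 * a) * 2 ^ (m * n)))"
    by (intro mult_le_mono1 binomial_le_pow True)
  finally show ?thesis by (simp only: mult.assoc)
next
  case False
  have "card T \<noteq> n + 2 * a" if "T \<subseteq> {..<m}" for T
    using card_mono[OF finite_lessThan that] False by auto
  then have "test_set n m a q = {}" by (auto simp: test_set_def)
  then show ?thesis by simp
qed

text \<open>The light rows of \<open>B\<close> themselves are the witness \<open>b\<close>.
  Relations among them persist in the product, and a relation \<open>c\<close> of the product makes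
  \<open>c b\<close> orthogonal to all columns of \<open>A\<close>, so that
  \<open>symp_annihilator_lagrangian\<close> applies.\<close>

lemma mmul_in_test_set:
  assumes B: "B \<in> mats m (2 * n)" and A: "A \<in> iso_fr n"
    and T: "T \<subseteq> {..<m}" "card T = n + 2 * a"
    and lt: "\<And>i. i \<in> T \<Longrightarrow> sweight n (\<lambda>l. of_bool (B i l)) < q"
  shows "mmul (2 * n) B A \<in> test_set n m a q"
proof -
  define J where "J = {..<2 * n}"
  define b :: "nat \<Rightarrow> nat \<Rightarrow> bit" where "b = restrict (\<lambda>i l. of_bool (B i l)) T"
  define ac :: "nat \<Rightarrow> nat \<Rightarrow> bit" where "ac = (\<lambda>j l. of_bool (A l j))"
  define ys where "ys = restr_cols n T (mmul (2 * n) B A)"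
  have fJ: "finite J" by (simp add: J_def)
  have bi: "b i \<in> bvecs J" if "i \<in> T" for i using B that by (auto simp: b_def bvecs_def mats_def J_def)
  have aj: "ac j \<in> bvecs J" for j using A by (auto simp: ac_def bvecs_def mats_def iso_fr_def J_def)
  have bP: "b \<in> T \<rightarrow>\<^sub>E light n q" using bi lt by (auto simp: light_def b_def J_def)
  have setys: "set ys = (\<lambda>j i. of_bool (i \<in> T \<and> mmul (2 * n) B A i j)) ` {..<n}"
    by (auto simp: ys_def restr_cols_def)
  \<comment> \<open>Associativity: \<open>c (B A) = (c B) A\<close>, read off in column
    \<open>j\<close>.\<close>
  have dy: "dot T c (\<lambda>i. of_bool (i \<in> T \<and> mmul (2 * n) B A i j)) = dot J (row_comb T b c) (ac j)" for c j
  proof -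
    have "mmul (2 * n) B A i j \<longleftrightarrow> odd (card {l\<in>J. B i l \<and> A l j})" for i
      by (simp add: mmul_def J_def)
    then have "(of_bool (i \<in> T \<and> mmul (2 * n) B A i j) :: bit) = dot J (b i) (ac j)" if "i \<in> T" for i
      using that of_bool_odd_card[OF fJ] by (simp add: dot_def b_def ac_def of_bool_conj)
    then show ?thesis unfolding dot_row_comb by (simp add: dot_def[of T])
  qed
  have iso: "symp n (ac j) (ac j') = 0" if "j < n" "j' < n" for j j'
  proof -
    have "symp n (ac j) (ac j') = (\<Sum>i<n. of_bool (A i j' \<and> A (n + i) j)) + (\<Sum>i<n. of_bool (A i j \<and> A (n + i) j'))"
      unfolding symp_def dot_def sum_lessThan_double
      by (simp add: half_swap_def ac_def of_bool_conj mult.commute)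
    also have "\<dots> = of_bool (odd (card {i. i < n \<and> A i j' \<and> A (n + i) j})) + of_bool (odd (card {i. i < n \<and> A i j \<and> A (n + i) j'}))"
      using of_bool_odd_card[of "{..<n}" "\<lambda>i. A i j' \<and> A (n + i) j"]
        of_bool_odd_card[of "{..<n}" "\<lambda>i. A i j \<and> A (n + i) j'"] by simp
    also have "\<dots> = 0"
      using A that by (auto simp: iso_fr_def symp_cols_def bit_add_self)
    finally show ?thesis .
  qed
  have inj: "x = 0" if x: "x \<in> bvecs {..<n}" "row_comb {..<n} ac x = 0" for x
  proof (rule ccontr)
    assume "x \<noteq> 0"
    \<comment> \<open>Full rank is stated through sets of columns; the set belonging to a
      coefficient vector is its support.\<close>
    define S where "S = {j. x j = 1}"
    have S: "S \<subseteq> {..<n}" "S \<noteq> {}" using x \<open>x \<noteq> 0\<close> by (auto simp: S_def bvecs_def fun_eq_iff)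
    then obtain i where i: "i < 2 * n" "odd (card {j\<in>S. A i j})"
      using A unfolding iso_fr_def full_col_rank_def by blast
    have "{j\<in>S. A i j} = {j\<in>{..<n}. x j = 1 \<and> A i j}" using S by (auto simp: S_def)
    then have "1 = (\<Sum>j<n. of_bool (x j = 1 \<and> A i j) :: bit)"
      using i of_bool_odd_card[of "{..<n}" "\<lambda>j. x j = 1 \<and> A i j"] by simp
    also have "\<dots> = row_comb {..<n} ac x i"
      unfolding row_comb_def ac_def by (intro sum.cong refl) auto
    finally show False using x by simp
  qed
  have "ys \<in> shadow n T b"
    unfolding shadow_def
  proof (intro CollectI conjI ballI impI)
    show "ys \<in> tuples (bvecs T) n" by (simp add: ys_def restr_cols_in)
    show "dot T c y = 0" if "row_comb T b c = 0" "y \<in> set ys" for c y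
    proof -
      from that obtain j where "y = (\<lambda>i. of_bool (i \<in> T \<and> mmul (2 * n) B A i j))" by (auto simp: setys)
      then have "dot T c y = dot J (row_comb T b c) (ac j)" by (simp only: dy)
      then show ?thesis using that by (simp add: dot_def)
    qed
    fix c c' assume c: "c \<in> annih (dot T) (bvecs T) ys" and c': "c' \<in> annih (dot T) (bvecs T) ys"
    have orth: "dot J (ac j) (row_comb T b d) = 0" if "d \<in> annih (dot T) (bvecs T) ys" "j < n" for d j
    proof -
      have "dot T (\<lambda>i. of_bool (i \<in> T \<and> mmul (2 * n) B A i j)) d = 0"
        using that by (auto simp: annih_def setys)
      then show ?thesis using dy[of d j] by (simp only: dot_commute)
    qed
    show "symp n (row_comb T b c) (row_comb T b c') = 0"
    proof (rule symp_annihilator_lagrangian[of n ac])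
      show "row_comb T b d \<in> bvecs {..<2 * n}" for d
        using row_comb_in[of T b J d] bi by (simp add: J_def)
      then show "row_comb T b c' \<in> bvecs {..<2 * n}" .
    qed (use orth c c' aj iso inj in \<open>simp_all add: J_def\<close>)
  qed
  moreover have "mmul (2 * n) B A \<in> mats m n"
    using A B by (auto simp: mats_def mmul_def iso_fr_def)
  ultimately show ?thesis using T bP unfolding test_set_def ys_def by blast
qed

section \<open>Light vectors, noise and total variation\<close>

abbreviation row_bits :: "bmat \<Rightarrow> nat \<Rightarrow> nat \<Rightarrow> bit" where
  "row_bits M i \<equiv> \<lambda>l. of_bool (M i l)"

text \<open>Chernoff-type bound: every light vector has \<open>x ^ sweight n b \<ge> x ^ q\<close>,
  while the sum of these powers over all vectors factors over the \<open>n\<close> coordinate pairs.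
  Each pair contributes 1 for its zero value and \<open>x\<close> for each of the three
  others.\<close>

lemma card_light:
  fixes x :: real
  assumes x: "0 < x" "x \<le> 1"
  shows "real (card (light n q)) * x ^ q \<le> (1 + 3 * x) ^ n"
proof -
  define \<phi> :: "bit \<times> bit \<Rightarrow> real" where "\<phi> = (\<lambda>z. if z = (0, 0) then 1 else x)"
  define Z :: "(bit \<times> bit) set" where "Z = {0, 1} \<times> {0, 1}"
  define g :: "(nat \<Rightarrow> bit) \<Rightarrow> nat \<Rightarrow> bit \<times> bit" where "g = (\<lambda>b. \<lambda>j\<in>{..<n}. (b j, b (n + j)))"
  have Z: "z \<in> Z" for z by (cases z) (auto simp: Z_def)
  have inj: "inj_on g (light n q)"
  proof (rule inj_onI)
    fix b b' assume b: "b \<in> light n q" "b' \<in> light n q" and eq: "g b = g b'"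
    show "b = b'"
    proof
      fix l
      consider "l < n" | "n \<le> l" "l < 2 * n" | "2 * n \<le> l" by linarith
      then show "b l = b' l"
      proof cases
        case 1
        then show ?thesis using fun_cong[OF eq, of l] by (simp add: g_def)
      next
        case 2
        then have "l - n < n" "n + (l - n) = l" by auto
        then show ?thesis using fun_cong[OF eq, of "l - n"] by (simp add: g_def)
      next
        case 3
        then show ?thesis using b by (simp add: light_def bvecs_def)
      qed
    qed
  qed
  have weight: "(\<Prod>j<n. \<phi> (g b j)) = x ^ sweight n b" for b
  proof -
    have "(\<Prod>j<n. \<phi> (g b j)) = (\<Prod>j<n. if b j = 1 \<or> b (n + j) = 1 then x else 1)"
      by (intro prod.cong) (auto simp: \<phi>_def g_def)
    also have "\<dots> = x ^ card {j\<in>{..<n}. b j = 1 \<or> b (n + j) = 1}"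
      by (subst prod.inter_filter[symmetric]) auto
    finally show ?thesis by (simp add: sweight_def)
  qed
  have "real (card (light n q)) * x ^ q = (\<Sum>b\<in>light n q. x ^ q)" by simp
  also have "\<dots> \<le> (\<Sum>b\<in>light n q. \<Prod>j<n. \<phi> (g b j))"
    unfolding weight using x by (intro sum_mono power_decreasing) (auto simp: light_def)
  also have "\<dots> = (\<Sum>h\<in>g ` light n q. \<Prod>j<n. \<phi> (h j))" by (simp add: sum.reindex[OF inj])
  also have "\<dots> \<le> (\<Sum>h\<in>{..<n} \<rightarrow>\<^sub>E Z. \<Prod>j<n. \<phi> (h j))"
    using x by (intro sum_mono2 finite_PiE prod_nonneg) (auto simp: g_def Z \<phi>_def Z_def split: if_splits)
  also have "\<dots> = (\<Prod>j<n. \<Sum>z\<in>Z. \<phi> z)"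
    by (rule prod_sum_PiE[symmetric]) (auto simp: Z_def)
  also have "(\<Sum>z\<in>Z. \<phi> z) = 1 + 3 * x"
    unfolding Z_def sum.cartesian_product[symmetric] by (simp add: \<phi>_def)
  finally show ?thesis by simp
qed

text \<open>If the row is nonzero on this pair, exactly two of the three nonzero errors flip the
  sign, so the mean is \<open>1 - 2 * (2 * p / 3)\<close>.\<close>

lemma expectation_pauli:
  assumes "0 \<le> p" "p \<le> 1"
  shows "measure_pmf.expectation (pauli_pmf p)
      (\<lambda>z. (if a \<and> fst z then -1 else 1) * (if b \<and> snd z then -1 else 1 :: real)) =
    (if a \<or> b then 1 - 4 * p / 3 else 1)"
  unfolding pauli_pmf_def using assms
  by (subst pmf_expectation_bind[of UNIV]) (auto simp: UNIV_bool integral_pmf_of_set field_simps)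

lemma finite_set_Pi_pauli: "finite (set_pmf (Pi_pmf {..<n::nat} (False, False) (\<lambda>_. pauli_pmf p)))"
  by (simp add: set_Pi_pmf finite_PiE_dflt)

lemma finite_set_Dp: "finite (set_pmf (Dp n p))"
  by (simp add: Dp_def finite_set_Pi_pauli)

lemma prod_lessThan_double: "prod f {..<2 * n} = prod f {..<n} * (\<Prod>i<n. f (n + i))"
  for f :: "nat \<Rightarrow> 'a::comm_monoid_mult"
proof -
  have "prod f {..<2 * n} = prod f {..<n} * prod f {n..<2 * n}"
    by (subst prod.union_disjoint[symmetric]) (auto intro!: prod.cong)
  also have "prod f {n..<2 * n} = (\<Prod>i<n. f (n + i))"
    using prod.shift_bounds_nat_ivl[of f 0 n n] by (simp add: mult_2 lessThan_atLeast0 add.commute)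
  finally show ?thesis .
qed

text \<open>A parity bit is \<open>(1 - s) / 2\<close> for its sign \<open>s\<close>, and the sign
  is a product over the independent pairs of coordinates; only pairs on which the row is nonzero
  contribute a factor different from 1.\<close>

lemma expectation_row:
  assumes p: "0 \<le> p" "p \<le> 1"
  shows "measure_pmf.expectation (Dp n p) (\<lambda>e. of_bool (mvec (2 * n) M e i)) =
    (1 - (1 - 4 * p / 3) ^ sweight n (row_bits M i)) / (2 :: real)"
proof -
  define s :: "nat \<Rightarrow> bool \<times> bool \<Rightarrow> real"
    where "s = (\<lambda>l z. (if M i l \<and> fst z then -1 else 1) * (if M i (n + l) \<and> snd z then -1 else 1))"
  define F :: "(nat \<Rightarrow> bool \<times> bool) \<Rightarrow> nat \<Rightarrow> bool"
    where "F = (\<lambda>f i. if i < n then fst (f i) else if i < 2 * n then snd (f (i - n)) else False)"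
  define D where "D = Pi_pmf {..<n} (False, False) (\<lambda>_. pauli_pmf p)"
  have sign: "of_bool (mvec (2 * n) M (F f) i) = (1 - (\<Prod>l<n. s l (f l))) / 2" for f
  proof -
    have "(\<Prod>l<2 * n. if M i l \<and> F f l then -1 else 1 :: real) = (-1) ^ card {l\<in>{..<2 * n}. M i l \<and> F f l}"
      by (subst prod.inter_filter[symmetric]) auto
    moreover have "(\<Prod>l<2 * n. if M i l \<and> F f l then -1 else 1 :: real) = (\<Prod>l<n. s l (f l))"
      unfolding prod_lessThan_double prod.distrib[symmetric] by (intro prod.cong) (auto simp: s_def F_def)
    ultimately show ?thesis by (auto simp: mvec_def)
  qed
  have bdd: "\<bar>s l z\<bar> \<le> 1" for l z by (simp add: s_def)
  have fin: "finite (set_pmf D)" unfolding D_def by (rule finite_set_Pi_pauli)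
  have "prob_space.indep_vars (measure_pmf D) (\<lambda>_. borel) (\<lambda>l f. s l (f l)) {..<n}"
    unfolding D_def by (rule prob_space.indep_vars_compose2[OF measure_pmf.prob_space_axioms indep_vars_Pi_pmf]) auto
  then have "measure_pmf.expectation D (\<lambda>f. \<Prod>l<n. s l (f l)) = (\<Prod>l<n. measure_pmf.expectation D (\<lambda>f. s l (f l)))"
    by (intro prob_space.indep_vars_lebesgue_integral[OF measure_pmf.prob_space_axioms] integrable_measure_pmf_finite fin) auto
  also have "\<dots> = (\<Prod>l<n. measure_pmf.expectation (pauli_pmf p) (s l))"
  proof (intro prod.cong refl)
    fix l assume "l \<in> {..<n}"
    then have "map_pmf (\<lambda>f. f l) D = pauli_pmf p" unfolding D_def by (subst Pi_pmf_component) auto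
    then show "measure_pmf.expectation D (\<lambda>f. s l (f l)) = measure_pmf.expectation (pauli_pmf p) (s l)"
      using integral_map_pmf[of "\<lambda>f. f l" D "s l"] by simp
  qed
  also have "\<dots> = (\<Prod>l<n. if M i l \<or> M i (n + l) then 1 - 4 * p / 3 else 1)"
    unfolding s_def by (intro prod.cong refl expectation_pauli p)
  also have "\<dots> = (1 - 4 * p / 3) ^ card {l\<in>{..<n}. M i l \<or> M i (n + l)}"
    by (subst prod.inter_filter[symmetric]) auto
  also have "card {l\<in>{..<n}. M i l \<or> M i (n + l)} = sweight n (row_bits M i)"
    by (simp add: sweight_def)
  finally have *: "measure_pmf.expectation D (\<lambda>f. \<Prod>l<n. s l (f l)) = (1 - 4 * p / 3) ^ sweight n (row_bits M i)" .
  have "Dp n p = map_pmf F D" by (simp add: Dp_def F_def D_def)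
  then have "measure_pmf.expectation (Dp n p) (\<lambda>e. of_bool (mvec (2 * n) M e i)) =
      measure_pmf.expectation D (\<lambda>f. (1 - (\<Prod>l<n. s l (f l))) / 2)"
    by (simp add: sign)
  also have "\<dots> = (1 - measure_pmf.expectation D (\<lambda>f. \<Prod>l<n. s l (f l))) / 2"
    by (simp add: integrable_measure_pmf_finite fin)
  finally show ?thesis unfolding * .
qed

text \<open>Linearity of expectation over the rows: a light row is bounded below by 0 and any other
  row by \<open>expectation_row\<close>.\<close>

lemma expectation_hweight_ge:
  assumes p: "0 \<le> p" "p \<le> 1"
  shows "(real m - real (card {i. i < m \<and> sweight n (row_bits M i) < q}) - real m * (1 - 2 * p / 3) ^ q) / 2 \<le>
    measure_pmf.expectation (Dp n p) (\<lambda>e. real (hweight m (mvec (2 * n) M e)))"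
proof -
  let ?w = "\<lambda>i. sweight n (row_bits M i)"
  let ?\<epsilon> = "(1 - 2 * p / 3) ^ q"
  have \<epsilon>: "0 \<le> ?\<epsilon>" "?\<epsilon> \<le> 1" using p by (auto intro: power_le_one)
  have row: "(1 - of_bool (?w i < q) - ?\<epsilon>) / 2 \<le> measure_pmf.expectation (Dp n p) (\<lambda>e. of_bool (mvec (2 * n) M e i))" for i
  proof (cases "?w i < q")
    case True
    have "0 \<le> measure_pmf.expectation (Dp n p) (\<lambda>e. of_bool (mvec (2 * n) M e i) :: real)"
      by (rule Bochner_Integration.integral_nonneg) simp
    moreover have "(1 - of_bool (?w i < q) - ?\<epsilon>) / 2 \<le> 0" using True \<epsilon> by simp
    ultimately show ?thesis by linarith
  next
    case False
    \<comment> \<open>For \<open>p > 3/4\<close> the base is negative; its absolute value is at most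
      \<open>1 - 2 * p / 3\<close> on the whole range of \<open>p\<close>, and powers of that base
      decrease in the exponent.\<close>
    have "(1 - 4 * p / 3) ^ ?w i \<le> \<bar>1 - 4 * p / 3\<bar> ^ ?w i" by (metis abs_ge_self power_abs)
    also have "\<dots> \<le> (1 - 2 * p / 3) ^ ?w i" using p by (intro power_mono) (auto simp: abs_if)
    also have "\<dots> \<le> ?\<epsilon>" using p False by (intro power_decreasing) auto
    finally show ?thesis using False by (simp add: expectation_row[OF p])
  qed
  have hw: "real (hweight m v) = (\<Sum>i<m. of_bool (v i))" for v
  proof -
    have "(\<Sum>i<m. of_bool (v i) :: real) = real (card {i\<in>{..<m}. v i})"
      by (simp add: of_bool_def sum.inter_filter[symmetric])
    then show ?thesis by (simp add: hweight_def)
  qed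
  have "(\<Sum>i<m. (1 - of_bool (?w i < q) - ?\<epsilon>) / 2 :: real) \<le>
      (\<Sum>i<m. measure_pmf.expectation (Dp n p) (\<lambda>e. of_bool (mvec (2 * n) M e i)))"
    by (intro sum_mono row)
  also have "\<dots> = measure_pmf.expectation (Dp n p) (\<lambda>e. real (hweight m (mvec (2 * n) M e)))"
    unfolding hw by (intro Bochner_Integration.integral_sum[symmetric] integrable_measure_pmf_finite finite_set_Dp)
  also have "(\<Sum>i<m. (1 - of_bool (?w i < q) - ?\<epsilon>) / 2 :: real) =
      (real m - real (hweight m (\<lambda>i. ?w i < q)) - real m * ?\<epsilon>) / 2"
    unfolding hw sum_divide_distrib[symmetric] by (simp add: sum_subtractf)
  finally show ?thesis by (simp add: hweight_def)
qed

section \<open>Transfer from the uniform matrix to the rows of \<open>B\<close>\<close>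

lemma prob_diff_le_tv_dist:
  "measure_pmf.prob P S - measure_pmf.prob Q S \<le> tv_dist P Q"
proof -
  have "\<bar>measure_pmf.prob P S - measure_pmf.prob Q S\<bar> \<le> tv_dist P Q"
    unfolding tv_dist_def
  proof (rule cSUP_upper)
    show "bdd_above (range (\<lambda>S. \<bar>measure_pmf.prob P S - measure_pmf.prob Q S\<bar>))"
    proof (rule bdd_aboveI2)
      fix S
      have "0 \<le> measure_pmf.prob P S" "0 \<le> measure_pmf.prob Q S" by (rule measure_nonneg)+
      then show "\<bar>measure_pmf.prob P S - measure_pmf.prob Q S\<bar> \<le> 1"
        using measure_pmf.prob_le_1[of P S] measure_pmf.prob_le_1[of Q S] by linarith
    qed
  qed simp
  then show ?thesis by linarith
qed

text \<open>The witness is the identity above a zero block. Being nonempty and finite, the set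
  carries a genuine uniform distribution \<open>pmf_of_set (iso_fr n)\<close>.\<close>

lemma iso_fr_nonempty: "iso_fr n \<noteq> {}"
proof -
  have "(\<lambda>i j. i = j \<and> j < n) \<in> iso_fr n"
    unfolding iso_fr_def
  proof (intro CollectI conjI allI impI)
    show "(\<lambda>i j. i = j \<and> j < n) \<in> mats (2 * n) n" by (auto simp: mats_def)
    show "full_col_rank (2 * n) n (\<lambda>i j. i = j \<and> j < n)"
      unfolding full_col_rank_def
    proof (intro allI impI)
      fix S assume S: "S \<subseteq> {..<n} \<and> S \<noteq> {}"
      then obtain i where i: "i \<in> S" "i < n" by auto
      then have "{j\<in>S. i = j \<and> j < n} = {i}" by auto
      then have "odd (card {j\<in>S. i = j \<and> j < n})" by simp
      then show "\<exists>i<2 * n. odd (card {j\<in>S. i = j \<and> j < n})" using i by (intro exI[of _ i]) auto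
    qed
    show "\<not> symp_cols n (\<lambda>i j. i = j \<and> j < n) j j'" if "j < n" "j' < n" for j j'
      using that by (auto simp: symp_cols_def)
  qed
  then show ?thesis by blast
qed

lemma finite_iso_fr: "finite (iso_fr n)"
  by (rule finite_subset[OF _ finite_mats[of "2 * n" n]]) (auto simp: iso_fr_def)

text \<open>Under the joint law of \<open>B\<close> and \<open>A\<close>, many light rows force the
  product into \<open>test_set\<close>. This event concerns the product only, so its probability
  differs from the uniform one by at most the total variation distance.\<close>

lemma prob_many_light_rows:
  assumes B: "set_pmf Bd \<subseteq> mats m (2 * n)"
  shows "measure_pmf.prob Bd {M. n + 2 * a \<le> card {i. i < m \<and> sweight n (row_bits M i) < q}} \<le>
    tv_dist (BA_dist n Bd) (pmf_of_set (mats m n)) + real (card (test_set n m a q)) / 2 ^ (m * n)"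
proof -
  let ?bad = "{M. n + 2 * a \<le> card {i. i < m \<and> sweight n (row_bits M i) < q}}"
  let ?U = "pmf_of_set (iso_fr n)"
  have dist: "BA_dist n Bd = map_pmf (\<lambda>(M, A). mmul (2 * n) M A) (pair_pmf Bd ?U)"
    by (simp add: BA_dist_def pair_pmf_def map_pmf_def bind_assoc_pmf bind_return_pmf)
  have "measure_pmf.prob Bd ?bad = measure_pmf.prob (map_pmf fst (pair_pmf Bd ?U)) ?bad"
    by (simp only: map_fst_pair_pmf)
  also have "\<dots> = measure_pmf.prob (pair_pmf Bd ?U) (fst -` ?bad)" by simp
  also have "\<dots> \<le> measure_pmf.prob (pair_pmf Bd ?U) ((\<lambda>(M, A). mmul (2 * n) M A) -` test_set n m a q)"
  proof (rule measure_pmf.finite_measure_mono_AE)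
    show "AE x in measure_pmf (pair_pmf Bd ?U). x \<in> fst -` ?bad \<longrightarrow> x \<in> (\<lambda>(M, A). mmul (2 * n) M A) -` test_set n m a q"
    proof (rule AE_pmfI, clarsimp)
      fix M A assume M: "M \<in> set_pmf Bd" and A: "A \<in> set_pmf ?U"
        and bad: "n + 2 * a \<le> card {i. i < m \<and> sweight n (row_bits M i) < q}"
      obtain T where T: "T \<subseteq> {i. i < m \<and> sweight n (row_bits M i) < q}" "card T = n + 2 * a"
        using obtain_subset_with_card_n[OF bad] by metis
      have "A \<in> iso_fr n" using A set_pmf_of_set[OF iso_fr_nonempty finite_iso_fr, of n] by simp
      then show "mmul (2 * n) M A \<in> test_set n m a q"
        by (intro mmul_in_test_set[where T = T]) (use M B T in auto)
    qed
  qed simp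
  also have "\<dots> = measure_pmf.prob (BA_dist n Bd) (test_set n m a q)" by (simp add: dist)
  also have "\<dots> \<le> tv_dist (BA_dist n Bd) (pmf_of_set (mats m n)) + measure_pmf.prob (pmf_of_set (mats m n)) (test_set n m a q)"
    using prob_diff_le_tv_dist[of "BA_dist n Bd" "test_set n m a q" "pmf_of_set (mats m n)"] by linarith
  also have "measure_pmf.prob (pmf_of_set (mats m n)) (test_set n m a q) = real (card (test_set n m a q)) / 2 ^ (m * n)"
  proof -
    have "mats m n \<noteq> {}" using card_mats[of m n] by (metis card.empty power_not_zero zero_neq_numeral)
    moreover have "mats m n \<inter> test_set n m a q = test_set n m a q" by (auto simp: test_set_def)
    ultimately show ?thesis by (simp add: measure_pmf_of_set card_mats)
  qed
  finally show ?thesis .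
qed

section \<open>Asymptotics\<close>

lemma superexponential_decay:
  fixes A K g :: real
  assumes "g > 0"
  shows "(\<lambda>n. real n ^ c * exp (A * real n + K * (real n * ln (real n)) - g * real n ^ 2)) \<longlonglongrightarrow> 0"
proof -
  have "(\<lambda>n. exp (real c * ln (real n) + A * real n + K * (real n * ln (real n)) - g * real n ^ 2)) \<longlonglongrightarrow> 0"
    using assms by real_asymp
  \<comment> \<open>Absorbing \<open>real n ^ c\<close> into the exponential needs
    \<open>n > 0\<close>.\<close>
  moreover have "\<forall>\<^sub>F n in sequentially. exp (real c * ln (real n) + A * real n + K * (real n * ln (real n)) - g * real n ^ 2)
      = real n ^ c * exp (A * real n + K * (real n * ln (real n)) - g * real n ^ 2)"
    using eventually_gt_at_top[of 0]
  proof eventually_elim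
    case (elim n)
    then have "exp (real c * ln (real n)) = real n ^ c" by (simp add: exp_of_nat_mult)
    then show ?case by (simp add: exp_add exp_diff)
  qed
  ultimately show ?thesis by (rule Lim_transform_eventually)
qed

text \<open>Exponential form of \<open>card_test_set\<close>: there are at most \<open>3 * n\<close>
  factors each of \<open>m\<close> and of the number of light vectors, the latter estimated by
  \<open>card_light\<close> and \<open>1 + 3 * x \<le> exp (3 * x)\<close>. Powers of 2 are
  estimated crudely by \<open>exp (1/2) \<le> 2 \<le> exp 1\<close>.\<close>

lemma card_test_set_exp:
  fixes x \<eta> \<mu> :: real
  assumes x: "0 < x" "x < 1" and \<eta>: "0 \<le> \<eta>" and a: "a \<le> n" and m: "1 \<le> m" "ln (real m) \<le> \<mu>"
  shows "real (card (test_set n m a (nat \<lceil>\<eta> * real n\<rceil>))) / 2 ^ (m * n) \<le>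
    exp (3 * real n * (\<mu> + 3 * x * real n + (\<eta> * real n + 1) * ln (1 / x) + 1) - (real a)\<^sup>2 / 2)"
proof -
  define q where "q = nat \<lceil>\<eta> * real n\<rceil>"
  define L where "L = real (card (light n q))"
  define k where "k = n + 2 * a"
  have q: "real q \<le> \<eta> * real n + 1" using \<eta> unfolding q_def
    by (simp add: of_nat_nat ceiling_correct)
  have lnx: "0 \<le> ln (1 / x)" using x by (simp add: ln_div)
  have \<mu>: "0 \<le> \<mu>" using m by (smt (verit) ln_ge_zero of_nat_1 of_nat_le_iff)
  define h where "h = 3 * x * real n + (\<eta> * real n + 1) * ln (1 / x)"
  have h: "0 \<le> h" using x \<eta> lnx by (simp add: h_def)
  have "L \<le> (1 + 3 * x) ^ n / x ^ q"
    using card_light[of x n q] x by (simp add: L_def pos_le_divide_eq)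
  also have "\<dots> \<le> exp (3 * x) ^ n * exp (real q * ln (1 / x))"
  proof -
    have "(1 + 3 * x) ^ n \<le> exp (3 * x) ^ n" using x by (intro power_mono) auto
    moreover have "1 / x ^ q = exp (real q * ln (1 / x))" using x by (simp add: exp_of_nat_mult power_one_over)
    moreover have "(1 + 3 * x) ^ n / x ^ q = (1 + 3 * x) ^ n * (1 / x ^ q)" by simp
    ultimately show ?thesis by (simp only: mult_right_mono exp_ge_zero)
  qed
  also have "\<dots> = exp (3 * x * real n + real q * ln (1 / x))"
    by (simp add: exp_add exp_of_nat_mult[symmetric] mult.commute)
  also have "\<dots> \<le> exp h" unfolding h_def using mult_right_mono[OF q lnx] by simp
  finally have L: "L \<le> exp h" .
  have k: "real k \<le> 3 * real n" using a by (simp add: k_def)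
  have "real (card (test_set n m a q)) * 2 ^ (a * a) \<le> real m ^ k * L ^ k * 2 ^ (3 * a) * 2 ^ (m * n)"
    using card_test_set[OF a, of m q, folded of_nat_le_iff[where 'a = real]] by (simp add: k_def L_def)
  then have "real (card (test_set n m a q)) / 2 ^ (m * n) \<le> real m ^ k * L ^ k * 2 ^ (3 * a) / 2 ^ (a * a)"
    by (simp add: divide_simps mult_ac)
  also have "\<dots> \<le> exp (3 * real n * \<mu>) * exp (3 * real n * h) * exp (3 * real n) / exp ((real a)\<^sup>2 / 2)"
  proof (intro frac_le mult_mono)
    have "real m ^ k = exp (real k * ln (real m))" using m by (simp add: exp_of_nat_mult)
    also have "\<dots> \<le> exp (3 * real n * \<mu>)" using k m by (simp add: mult_mono)
    finally show "real m ^ k \<le> exp (3 * real n * \<mu>)" .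
    have "L ^ k \<le> exp h ^ k" by (rule power_mono[OF L]) (simp add: L_def)
    also have "\<dots> = exp (real k * h)" by (simp add: exp_of_nat_mult)
    also have "\<dots> \<le> exp (3 * real n * h)" using k h by (simp add: mult_right_mono)
    finally show "L ^ k \<le> exp (3 * real n * h)" .
    have "(2::real) ^ (3 * a) \<le> exp 1 ^ (3 * a)" using exp_ge_add_one_self[of 1] by (intro power_mono) auto
    also have "\<dots> = exp (real (3 * a))" by (simp only: exp_of_nat_mult[symmetric] mult_1_right)
    also have "\<dots> \<le> exp (3 * real n)" using a by simp
    finally show "2 ^ (3 * a) \<le> exp (3 * real n)" .
    have "exp ((real a)\<^sup>2 / 2) = exp (1 / 2) ^ (a * a)"
      by (simp only: exp_of_nat_mult[symmetric]) (simp add: power2_eq_square)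
    also have "\<dots> \<le> 2 ^ (a * a)"
      using exp_half_le2 by (intro power_mono) auto
    finally show "exp ((real a)\<^sup>2 / 2) \<le> 2 ^ (a * a)" .
  qed (auto simp: L_def)
  also have "\<dots> = exp (3 * real n * (\<mu> + h + 1) - (real a)\<^sup>2 / 2)"
    by (simp add: exp_diff exp_add[symmetric] algebra_simps)
  finally show ?thesis by (simp add: q_def h_def add.assoc)
qed

lemma negligible_mono_add:
  assumes f: "negligible f" and g: "\<And>c. (\<lambda>n. real n ^ c * g n) \<longlonglongrightarrow> 0"
    and le: "\<forall>\<^sub>F n in sequentially. 0 \<le> h n \<and> h n \<le> f n + g n"
  shows "negligible h"
  unfolding negligible_def
proof
  fix c
  have "(\<lambda>n. real n ^ c * \<bar>f n\<bar> + real n ^ c * g n) \<longlonglongrightarrow> 0 + 0"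
    using f g by (intro tendsto_add) (auto simp: negligible_def)
  then have lim: "(\<lambda>n. real n ^ c * \<bar>f n\<bar> + real n ^ c * g n) \<longlonglongrightarrow> 0" by simp
  show "(\<lambda>n. real n ^ c * \<bar>h n\<bar>) \<longlonglongrightarrow> 0"
  proof (rule Lim_null_comparison[OF _ lim])
    show "\<forall>\<^sub>F n in sequentially. norm (real n ^ c * \<bar>h n\<bar>) \<le> real n ^ c * \<bar>f n\<bar> + real n ^ c * g n"
      using le
    proof eventually_elim
      case (elim n)
      then have "real n ^ c * \<bar>h n\<bar> \<le> real n ^ c * (\<bar>f n\<bar> + g n)" by (intro mult_left_mono) auto
      then show ?case by (simp add: distrib_left)
    qed
  qed
qed

theorem theoremD2:
  fixes m :: "nat \<Rightarrow> nat" and p :: "nat \<Rightarrow> real"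
    and B :: "nat \<Rightarrow> bmat pmf" and \<delta> :: real
  assumes m_poly: "\<exists>k C. \<forall>n. real (m n) \<le> C * real n ^ k + C"
    and m_lin: "\<exists>c>1. \<forall>\<^sub>F n in sequentially. real (m n) > c * real n"
    and p_range: "\<forall>n. 0 \<le> p n \<and> p n \<le> 1"
    and p_omega: "filterlim (\<lambda>n. real n * p n) at_top sequentially"
    and B_dim: "\<forall>n. set_pmf (B n) \<subseteq> mats (m n) (2 * n)"
    and BA_unif: "negligible (\<lambda>n. tv_dist (BA_dist n (B n)) (pmf_of_set (mats (m n) n)))"
    and \<delta>_pos: "\<delta> > 0"
  shows "negligible (\<lambda>n. 1 - measure_pmf.prob (B n)
           {Bm. measure_pmf.expectation (Dp n (p n)) (\<lambda>e. real (hweight (m n) (mvec (2 * n) Bm e)))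
                \<ge> (1 - real n / real (m n) - \<delta>) / 2 * real (m n)})"
proof -
  define \<gamma> where "\<gamma> = min 1 (\<delta> / 4)"
  \<comment> \<open>\<open>x\<close> and \<open>\<eta>\<close> are chosen such that \<open>9x + 3\<eta> ln (1/x) = \<gamma>^2/16\<close>, half of the gain \<open>a^2 / (2 n^2) \<ge> \<gamma>^2/8\<close>.\<close>
  define x where "x = \<gamma>\<^sup>2 / 288"
  define \<eta> where "\<eta> = \<gamma>\<^sup>2 / (96 * ln (1 / x))"
  \<comment> \<open>Fewer than \<open>n + 2 * a n\<close> light rows exceed \<open>n\<close> by at
    most \<open>2 * \<gamma> * n\<close>, which is at most \<open>\<delta> * n / 2\<close>.\<close>
  define a where "a = (\<lambda>n. nat \<lfloor>\<gamma> * real n\<rfloor>)"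
  define q where "q = (\<lambda>n. nat \<lceil>\<eta> * real n\<rceil>)"
  have \<gamma>: "0 < \<gamma>" "\<gamma> \<le> 1" "\<gamma> \<le> \<delta> / 4" using \<delta>_pos by (auto simp: \<gamma>_def)
  have "\<gamma>\<^sup>2 \<le> 1" using \<gamma> by (simp add: power_le_one)
  then have x: "0 < x" "x < 1" using \<gamma> by (auto simp: x_def)
  then have lnx: "0 < ln (1 / x)" by (simp add: ln_div)
  then have \<eta>: "0 < \<eta>" using \<gamma> by (simp add: \<eta>_def)
  have a_le: "real (a n) \<le> \<gamma> * real n" for n
    using \<gamma> by (simp add: a_def)
  obtain K C where mC: "\<And>n. real (m n) \<le> C * real n ^ K + C" using m_poly by blast
  define M where "M = ln (2 * \<bar>C\<bar> + 1)"
  define A where "A = 3 * (M + ln (1 / x) + 1)"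
  define g where "g = (\<lambda>n. exp (A * real n + 3 * real K * (real n * ln (real n)) - \<gamma>\<^sup>2 / 16 * real n ^ 2))"
  have g0: "(\<lambda>n. real n ^ c * g n) \<longlonglongrightarrow> 0" for c
    unfolding g_def using \<gamma> by (intro superexponential_decay) auto
  obtain c where c: "c > 1" "\<forall>\<^sub>F n in sequentially. real (m n) > c * real n" using m_lin by blast
  \<comment> \<open>The constant is the one for which
    \<open>exp (- (2/3) * p n * \<eta> * n)\<close> is at most \<open>\<delta> / 2\<close>.\<close>
  have ev_p: "\<forall>\<^sub>F n in sequentially. real n * p n \<ge> 3 / (2 * \<eta>) * ln (2 / \<delta>)"
    using p_omega by (auto simp: filterlim_at_top)
  \<comment> \<open>From \<open>2 / \<gamma>\<close> on, rounding down in \<open>a\<close> loses at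
    most half of \<open>\<gamma> * n\<close>.\<close>
  have ev_n: "\<forall>\<^sub>F n in sequentially. n \<ge> max 1 (nat \<lceil>2 / \<gamma>\<rceil>)" by (rule eventually_ge_at_top)
  show ?thesis
  proof (rule negligible_mono_add[OF BA_unif g0])
    show "\<forall>\<^sub>F n in sequentially. 0 \<le> 1 - measure_pmf.prob (B n)
           {Bm. measure_pmf.expectation (Dp n (p n)) (\<lambda>e. real (hweight (m n) (mvec (2 * n) Bm e)))
                \<ge> (1 - real n / real (m n) - \<delta>) / 2 * real (m n)}
        \<and> 1 - measure_pmf.prob (B n)
           {Bm. measure_pmf.expectation (Dp n (p n)) (\<lambda>e. real (hweight (m n) (mvec (2 * n) Bm e)))
                \<ge> (1 - real n / real (m n) - \<delta>) / 2 * real (m n)}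
          \<le> tv_dist (BA_dist n (B n)) (pmf_of_set (mats (m n) n)) + g n"
      using c(2) ev_p ev_n
    proof eventually_elim
      case (elim n)
      let ?good = "{Bm. measure_pmf.expectation (Dp n (p n)) (\<lambda>e. real (hweight (m n) (mvec (2 * n) Bm e)))
                \<ge> (1 - real n / real (m n) - \<delta>) / 2 * real (m n)}"
      let ?bad = "{M. n + 2 * a n \<le> card {i. i < m n \<and> sweight n (row_bits M i) < q n}}"
      have n: "real n \<ge> 1" "real n \<ge> 2 / \<gamma>" using elim(3) by (auto simp: nat_le_iff ceiling_le_iff)
      have "1 * real n \<le> c * real n" using c by (intro mult_right_mono) auto
      then have mn: "real n < real (m n)" using elim(1) by linarith
      have a_n: "a n \<le> n"
      proof -
        have "\<gamma> * real n \<le> 1 * real n" using \<gamma> by (intro mult_right_mono) auto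
        then show ?thesis using a_le[of n] by simp
      qed
      have a_ge: "\<gamma> * real n / 2 \<le> real (a n)"
      proof -
        have "2 \<le> \<gamma> * real n" using n \<gamma> by (simp add: divide_le_eq mult.commute)
        moreover have "\<gamma> * real n - 1 \<le> real (a n)" unfolding a_def by linarith
        ultimately show ?thesis by linarith
      qed
      \<comment> \<open>The allowance \<open>\<delta> * m\<close> is split evenly between the light
        rows beyond \<open>n\<close> and the residual bias of the other rows.\<close>
      have combine: "(u - v - d) / 2 \<le> w" if "k \<le> v + d / 2" "e \<le> d / 2" "(u - k - e) / 2 \<le> w" for u v d w k e :: real
        using that by simp
      have pn: "0 \<le> p n" "p n \<le> 1" using p_range by auto
      have "(1 - 2 * p n / 3) ^ q n \<le> exp (- (2 * p n / 3)) ^ q n"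
        using pn exp_ge_add_one_self[of "- (2 * p n / 3)"] by (intro power_mono) auto
      also have "\<dots> = exp (- (2 / 3 * p n * real (q n)))"
        by (simp add: exp_of_nat_mult[symmetric] mult_ac)
      also have "\<dots> \<le> exp (- ln (2 / \<delta>))"
      proof -
        have "ln (2 / \<delta>) \<le> 2 / 3 * \<eta> * (real n * p n)"
          using elim(2) \<eta> by (simp add: field_simps)
        also have "\<dots> = 2 / 3 * p n * (\<eta> * real n)" by simp
        also have "\<dots> \<le> 2 / 3 * p n * real (q n)"
          using pn unfolding q_def by (intro mult_left_mono) (auto intro: order_trans[OF le_of_int_ceiling])
        finally show ?thesis by simp
      qed
      also have "\<dots> = \<delta> / 2" using \<delta>_pos by (simp add: exp_minus)
      finally have \<epsilon>: "(1 - 2 * p n / 3) ^ q n \<le> \<delta> / 2" .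
      \<comment> \<open>A matrix without too many light rows has large expected weight, so failure
        implies the event bounded by \<open>prob_many_light_rows\<close>.\<close>
      have "UNIV - ?good \<subseteq> ?bad"
      proof (rule ccontr)
        assume "\<not> UNIV - ?good \<subseteq> ?bad"
        then obtain Bm where Bm: "Bm \<notin> ?good" "Bm \<notin> ?bad" by blast
        have "real (card {i. i < m n \<and> sweight n (row_bits Bm i) < q n}) \<le> real n + 2 * real (a n)"
          using Bm(2) by simp
        also have "\<dots> \<le> real n + \<delta> * real (m n) / 2"
        proof -
          have "\<gamma> * real n \<le> \<delta> / 4 * real (m n)" using \<gamma> mn by (intro mult_mono) auto
          then show ?thesis using a_le[of n] by simp
        qed
        finally have "real (card {i. i < m n \<and> sweight n (row_bits Bm i) < q n}) \<le> real n + \<delta> * real (m n) / 2" .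
        moreover have "real (m n) * (1 - 2 * p n / 3) ^ q n \<le> \<delta> * real (m n) / 2"
          using mult_left_mono[OF \<epsilon>, of "real (m n)"] by (simp add: mult.commute)
        ultimately have "(real (m n) - real n - \<delta> * real (m n)) / 2 \<le>
            measure_pmf.expectation (Dp n (p n)) (\<lambda>e. real (hweight (m n) (mvec (2 * n) Bm e)))"
          by (rule combine) (rule expectation_hweight_ge[OF pn])
        moreover have "(1 - real n / real (m n) - \<delta>) / 2 * real (m n) = (real (m n) - real n - \<delta> * real (m n)) / 2"
          using mn by (simp add: field_simps)
        ultimately show False using Bm(1) by simp
      qed
      then have "measure_pmf.prob (B n) (UNIV - ?good) \<le> measure_pmf.prob (B n) ?bad"
        by (intro measure_pmf.finite_measure_mono) auto
      also have "\<dots> \<le> tv_dist (BA_dist n (B n)) (pmf_of_set (mats (m n) n)) +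
          real (card (test_set n (m n) (a n) (q n))) / 2 ^ (m n * n)"
        using B_dim by (intro prob_many_light_rows) auto
      also have "real (card (test_set n (m n) (a n) (q n))) / 2 ^ (m n * n) \<le> g n"
      proof -
        \<comment> \<open>The sign of \<open>C\<close> is unknown, hence
          \<open>\<bar>C\<bar>\<close>; the additive constant is absorbed because
          \<open>real n ^ K \<ge> 1\<close>, and the extra 1 keeps the coefficient positive.\<close>
        have "ln (real (m n)) \<le> ln ((2 * \<bar>C\<bar> + 1) * real n ^ K)"
        proof -
          have one: "1 \<le> real n ^ K" using n by simp
          have "real (m n) \<le> \<bar>C\<bar> * real n ^ K + \<bar>C\<bar> * 1"
            using mC[of n] n by (smt (verit) abs_ge_self mult_right_mono zero_le_power)
          also have "\<dots> \<le> \<bar>C\<bar> * real n ^ K + \<bar>C\<bar> * real n ^ K" using one by (intro add_left_mono mult_left_mono) auto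
          also have "\<dots> \<le> (2 * \<bar>C\<bar> + 1) * real n ^ K" using one by (simp add: algebra_simps)
          finally show ?thesis using mn n by simp
        qed
        also have "\<dots> = M + real K * ln (real n)"
          using n by (simp add: M_def ln_mult ln_realpow)
        finally have "real (card (test_set n (m n) (a n) (q n))) / 2 ^ (m n * n) \<le>
          exp (3 * real n * (M + real K * ln (real n) + 3 * x * real n + (\<eta> * real n + 1) * ln (1 / x) + 1) - (real (a n))\<^sup>2 / 2)"
          unfolding q_def using x \<eta> a_n mn by (intro card_test_set_exp) auto
        also have "\<dots> \<le> g n"
        proof -
          have "(\<gamma> * real n / 2)\<^sup>2 \<le> (real (a n))\<^sup>2" using \<gamma> by (intro power_mono a_ge) auto
          then have "\<gamma>\<^sup>2 * (real n)\<^sup>2 / 8 \<le> (real (a n))\<^sup>2 / 2" by (simp add: power_mult_distrib power_divide)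
          \<comment> \<open>Sorting by order of growth: only the quadratic term competes with the
            gain, with coefficient \<open>\<gamma>^2 / 16\<close> against
            \<open>\<gamma>^2 / 8\<close>, which leaves the quadratic term of
            \<open>g\<close>.\<close>
          moreover have "3 * real n * (M + real K * ln (real n) + 3 * x * real n + (\<eta> * real n + 1) * ln (1 / x) + 1) =
              A * real n + 3 * real K * (real n * ln (real n)) + 3 * (3 * x + \<eta> * ln (1 / x)) * (real n)\<^sup>2"
            by (simp only: A_def ring_distribs power2_eq_square mult_ac add_ac mult_1_left mult_1_right)
          moreover have "\<eta> * ln (1 / x) = \<gamma>\<^sup>2 / 96" using lnx by (simp add: \<eta>_def)
          then have "3 * x + \<eta> * ln (1 / x) = \<gamma>\<^sup>2 / 48" by (simp add: x_def)
          ultimately show ?thesis unfolding g_def by simp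
        qed
        finally show ?thesis .
      qed
      finally have "measure_pmf.prob (B n) (UNIV - ?good) \<le> tv_dist (BA_dist n (B n)) (pmf_of_set (mats (m n) n)) + g n"
        by simp
      moreover have "measure_pmf.prob (B n) (UNIV - ?good) = 1 - measure_pmf.prob (B n) ?good"
        using measure_pmf.prob_compl[of ?good "B n"] by simp
      ultimately show ?case by simp
    qed
  qed
qed

end
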